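(* Let $M$ be a finite LTS, $B\subseteq\mathit{Act}$, $\rho$ a regular formula, $\alpha_f,\alpha_e\subseteq\mathit{Act}$. $M$ satisfies $$\neg\langle\rho\cdot\overline{\alpha_f}^{\,*}\rangle\Big(\langle\alpha_e\rangle\mathit{tt}\lor[\overline{B}]\mathit{ff}\lor\bigvee_{\emptyset\neq F\subseteq\overline{B}}\nu X.\Big(\bigwedge_{a\in F}\mu W.\Big(\big(\bigwedge_{b\in\overline{B}\setminus F}[\overline{B}^{\,*}\cdot b]\mathit{ff}\big)\land\big(\langle\{a\}\setminus\alpha_f\rangle X\lor\langle\overline{\alpha_f}\rangle W\big)\Big)\Big)\Big)$$ if, and only if, its initial state does not admit a path that is $B$-progressing, satisfies strong $B$-hyperfairness of actions, and is $(\rho,\alpha_f,\alpha_e)$-violating.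
   Context: LTS $M=(S,s_{init},\mathit{Act},\mathit{Trans})$ with $S,\mathit{Act}$ finite; $M$ satisfies a closed formula if $s_{init}$ does. Paths: alternating sequences $s_0t_1s_1\dots$ starting in a state, infinite or ending in a state, consecutive. An action occurs on a path if a transition on it carries that label; $\alpha$-free = no action of $\alpha$ occurs. An action is enabled in $s$ if a transition with that label leaves $s$. $\overline{\alpha}=\mathit{Act}\setminus\alpha$. A state $s$ is $B$-reachable from $s'$ if some $B$-free path from $s'$ ends in $s$; an action $a$ is $B$-reachable from $s$ if enabled in some state $B$-reachable from $s$; $a$ is relentlessly $B$-reachable on a path if every suffix contains a state from which $a$ is $B$-reachable. A state is $B$-locked if all actions enabled in it are in $B$; a path is $B$-progressing if infinite or ending in a $B$-locked state. A path $\pi$ satisfies strong $B$-hyperfairness of actions iff for every suffix $\pi'$ of $\pi$, every $a\in\overline{B}$ relentlessly $B$-reachable in $\pi'$ occurs in $\pi'$. Regular formulae $R::=\varepsilon\mid\alpha\mid R\cdot Q\mid R+Q\mid R^*$; a finite path matches $R$ if its label sequence lies in the language of $R$. A path $\pi$ is $(\rho,\alpha_f,\alpha_e)$-violating if $\pi=\pi_{pre}\cdot\pi_{suf}$ with $\pi_{pre}$ finite matching $\rho$ and $\pi_{suf}$ either $\alpha_f$-free, or containing an action of $\alpha_e$ with the prefix before its first such occurrence $\alpha_f$-free. Modal $\mu$-calculus with standard semantics and abbreviations: $\mathit{tt}$, $\land$, $[R]\phi=\neg\langle R\rangle\neg\phi$, $\nu$ greatest fixpoint, single action denotes its singleton,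 $\langle\alpha\rangle\phi=\bigvee_{b\in\alpha}\langle b\rangle\phi$, $\langle R\cdot Q\rangle\phi=\langle R\rangle\langle Q\rangle\phi$, $\langle R+Q\rangle\phi=\langle R\rangle\phi\lor\langle Q\rangle\phi$, $\langle R^*\rangle\phi=\mu Y.(\langle R\rangle Y\lor\phi)$, $\langle\varepsilon\rangle\phi=\phi$. *)

theory Defs
  imports Main "HOL-Library.Extended_Nat"
begin

section \<open>Labelled transition systems\<close>

type_synonym ('s, 'a) transition = "'s \<times> 'a \<times> 's"

abbreviation src :: "('s, 'a) transition \<Rightarrow> 's" where "src t \<equiv> fst t"
abbreviation label :: "('s, 'a) transition \<Rightarrow> 'a" where "label t \<equiv> fst (snd t)"
abbreviation tgt :: "('s, 'a) transition \<Rightarrow> 's" where "tgt t \<equiv> snd (snd t)"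

record ('s, 'a) lts =
  states :: "'s set"
  init :: 's
  acts :: "'a set"
  transitions :: "('s, 'a) transition set"

definition finite_lts :: "('s, 'a) lts \<Rightarrow> bool" where
  "finite_lts M \<longleftrightarrow> finite (states M) \<and> init M \<in> states M \<and> finite (acts M)
     \<and> transitions M \<subseteq> states M \<times> acts M \<times> states M"

definition enabled :: "('s, 'a) lts \<Rightarrow> 's \<Rightarrow> 'a \<Rightarrow> bool" where
  "enabled M s a \<longleftrightarrow> (\<exists>s'. (s, a, s') \<in> transitions M)"

section \<open>Finite and infinite paths\<close>

text \<open>
  A path with \<open>n\<close> transitions (\<open>n = \<infinity>\<close> if it is infinite) is \<open>s\<^sub>0 t\<^sub>0 s\<^sub>1 t\<^sub>1 \<dots>\<close> with states
  \<open>pstate \<pi> i\<close> for \<open>i \<le> n\<close> and transitions \<open>ptrans \<pi> i\<close> for \<open>i < n\<close>; the values of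
  both functions beyond these positions are never inspected.
\<close>

record ('s, 'a) path =
  plen :: enat
  pstate :: "nat \<Rightarrow> 's"
  ptrans :: "nat \<Rightarrow> ('s, 'a) transition"

definition is_path :: "('s, 'a) lts \<Rightarrow> ('s, 'a) path \<Rightarrow> bool" where
  "is_path M \<pi> \<longleftrightarrow> pstate \<pi> 0 \<in> states M \<and>
     (\<forall>i. enat i < plen \<pi> \<longrightarrow> ptrans \<pi> i \<in> transitions M
        \<and> src (ptrans \<pi> i) = pstate \<pi> i \<and> tgt (ptrans \<pi> i) = pstate \<pi> (Suc i))"

text \<open>
  For \<open>enat k \<le> plen \<pi>\<close>, the decompositions of \<open>\<pi>\<close> as a concatenation of a finite path
  and a path are exactly those into \<open>path_take k \<pi>\<close> and \<open>path_drop k \<pi>\<close>.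
\<close>

definition path_take :: "nat \<Rightarrow> ('s, 'a) path \<Rightarrow> ('s, 'a) path" where
  "path_take k \<pi> = \<lparr>plen = enat k, pstate = pstate \<pi>, ptrans = ptrans \<pi>\<rparr>"

definition path_drop :: "nat \<Rightarrow> ('s, 'a) path \<Rightarrow> ('s, 'a) path" where
  "path_drop k \<pi> = \<lparr>plen = plen \<pi> - enat k,
     pstate = (\<lambda>i. pstate \<pi> (k + i)), ptrans = (\<lambda>i. ptrans \<pi> (k + i))\<rparr>"

definition path_suffixes :: "('s, 'a) path \<Rightarrow> ('s, 'a) path set" where
  "path_suffixes \<pi> = {path_drop k \<pi> | k. enat k \<le> plen \<pi>}"

definition contains_state :: "('s, 'a) path \<Rightarrow> 's \<Rightarrow> bool" where
  "contains_state \<pi> s \<longleftrightarrow> (\<exists>i. enat i \<le> plen \<pi> \<and> pstate \<pi> i = s)"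

definition ends_in :: "('s, 'a) path \<Rightarrow> 's \<Rightarrow> bool" where
  "ends_in \<pi> s \<longleftrightarrow> (\<exists>n. plen \<pi> = enat n \<and> pstate \<pi> n = s)"

definition occurs :: "('s, 'a) path \<Rightarrow> 'a \<Rightarrow> bool" where
  "occurs \<pi> a \<longleftrightarrow> (\<exists>i. enat i < plen \<pi> \<and> label (ptrans \<pi> i) = a)"

definition free_of :: "'a set \<Rightarrow> ('s, 'a) path \<Rightarrow> bool" where
  "free_of A \<pi> \<longleftrightarrow> (\<forall>a\<in>A. \<not> occurs \<pi> a)"

section \<open>Progress and strong hyperfairness of actions\<close>

definition state_reachable :: "('s, 'a) lts \<Rightarrow> 'a set \<Rightarrow> 's \<Rightarrow> 's \<Rightarrow> bool" where
  "state_reachable M B s' s \<longleftrightarrow>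
     (\<exists>\<pi>. is_path M \<pi> \<and> free_of B \<pi> \<and> pstate \<pi> 0 = s' \<and> ends_in \<pi> s)"

definition action_reachable :: "('s, 'a) lts \<Rightarrow> 'a set \<Rightarrow> 's \<Rightarrow> 'a \<Rightarrow> bool" where
  "action_reachable M B s a \<longleftrightarrow> (\<exists>s'. state_reachable M B s s' \<and> enabled M s' a)"

definition relentlessly_reachable :: "('s, 'a) lts \<Rightarrow> 'a set \<Rightarrow> ('s, 'a) path \<Rightarrow> 'a \<Rightarrow> bool" where
  "relentlessly_reachable M B \<pi> a \<longleftrightarrow>
     (\<forall>\<pi>'\<in>path_suffixes \<pi>. \<exists>s. contains_state \<pi>' s \<and> action_reachable M B s a)"

definition locked :: "('s, 'a) lts \<Rightarrow> 'a set \<Rightarrow> 's \<Rightarrow> bool" where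
  "locked M B s \<longleftrightarrow> (\<forall>a. enabled M s a \<longrightarrow> a \<in> B)"

definition progressing :: "('s, 'a) lts \<Rightarrow> 'a set \<Rightarrow> ('s, 'a) path \<Rightarrow> bool" where
  "progressing M B \<pi> \<longleftrightarrow> plen \<pi> = \<infinity> \<or> (\<exists>s. ends_in \<pi> s \<and> locked M B s)"

definition strong_hyperfair :: "('s, 'a) lts \<Rightarrow> 'a set \<Rightarrow> ('s, 'a) path \<Rightarrow> bool" where
  "strong_hyperfair M B \<pi> \<longleftrightarrow>
     (\<forall>\<pi>'\<in>path_suffixes \<pi>. \<forall>a\<in>acts M - B. relentlessly_reachable M B \<pi>' a \<longrightarrow> occurs \<pi>' a)"

section \<open>Regular formulae and violating paths\<close>

datatype 'a regular =
    Eps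
  | Acts "'a set"
  | Seq "'a regular" "'a regular"
  | Alt "'a regular" "'a regular"
  | Star "'a regular"

primrec regular_over :: "'a set \<Rightarrow> 'a regular \<Rightarrow> bool" where
  "regular_over Act Eps \<longleftrightarrow> True"
| "regular_over Act (Acts A) \<longleftrightarrow> A \<subseteq> Act"
| "regular_over Act (Seq R Q) \<longleftrightarrow> regular_over Act R \<and> regular_over Act Q"
| "regular_over Act (Alt R Q) \<longleftrightarrow> regular_over Act R \<and> regular_over Act Q"
| "regular_over Act (Star R) \<longleftrightarrow> regular_over Act R"

primrec lang :: "'a regular \<Rightarrow> 'a list set" where
  "lang Eps = {[]}"
| "lang (Acts A) = {[a] | a. a \<in> A}"
| "lang (Seq R Q) = {u @ v | u v. u \<in> lang R \<and> v \<in> lang Q}"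
| "lang (Alt R Q) = lang R \<union> lang Q"
| "lang (Star R) = {concat ws | ws. set ws \<subseteq> lang R}"

definition matches :: "('s, 'a) path \<Rightarrow> 'a regular \<Rightarrow> bool" where
  "matches \<pi> R \<longleftrightarrow> (\<exists>n. plen \<pi> = enat n \<and> map (\<lambda>i. label (ptrans \<pi> i)) [0..<n] \<in> lang R)"

definition violating :: "'a regular \<Rightarrow> 'a set \<Rightarrow> 'a set \<Rightarrow> ('s, 'a) path \<Rightarrow> bool" where
  "violating \<rho> \<alpha>f \<alpha>e \<pi> \<longleftrightarrow>
     (\<exists>k. enat k \<le> plen \<pi> \<and> matches (path_take k \<pi>) \<rho> \<and>
        (let \<sigma> = path_drop k \<pi> in
           free_of \<alpha>f \<sigma> \<or>
           (\<exists>j. enat j < plen \<sigma> \<and> label (ptrans \<sigma> j) \<in> \<alpha>e \<and> free_of \<alpha>e (path_take j \<sigma>)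
              \<and> free_of \<alpha>f (path_take j \<sigma>))))"

section \<open>The modal mu-calculus\<close>

type_synonym var = string

datatype 'a form =
    FF
  | Var var
  | Neg "'a form"
  | Or "'a form" "'a form"
  | Dia 'a "'a form"
  | Mu var "'a form"
  | Nu var "'a form"

text \<open>
  The fixpoint clauses use the Knaster-Tarski characterisation in the lattice of subsets of
  \<open>states M\<close>. As usual they are meant for formulae in which fixpoint variables occur positively.
\<close>

primrec sem :: "('s, 'a) lts \<Rightarrow> (var \<Rightarrow> 's set) \<Rightarrow> 'a form \<Rightarrow> 's set" where
  "sem M e FF = {}"
| "sem M e (Var X) = e X"
| "sem M e (Neg \<phi>) = states M - sem M e \<phi>"
| "sem M e (Or \<phi> \<psi>) = sem M e \<phi> \<union> sem M e \<psi>"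
| "sem M e (Dia a \<phi>) = {s \<in> states M. \<exists>s'. (s, a, s') \<in> transitions M \<and> s' \<in> sem M e \<phi>}"
| "sem M e (Mu X \<phi>) = \<Inter>{T. T \<subseteq> states M \<and> sem M (e(X := T)) \<phi> \<subseteq> T}"
| "sem M e (Nu X \<phi>) = \<Union>{T. T \<subseteq> states M \<and> T \<subseteq> sem M (e(X := T)) \<phi>}"

text \<open>Intended for closed formulae, for which the choice of environment is irrelevant.\<close>

definition satisfies :: "('s, 'a) lts \<Rightarrow> 'a form \<Rightarrow> bool" where
  "satisfies M \<phi> \<longleftrightarrow> init M \<in> sem M (\<lambda>_. {}) \<phi>"

definition TT :: "'a form" where
  "TT = Neg FF"

definition And :: "'a form \<Rightarrow> 'a form \<Rightarrow> 'a form" where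
  "And \<phi> \<psi> = Neg (Or (Neg \<phi>) (Neg \<psi>))"

text \<open>
  Disjunction and conjunction over a finite index set, taken in an arbitrary but fixed
  enumeration of that set.
\<close>

definition big_or :: "'i set \<Rightarrow> ('i \<Rightarrow> 'a form) \<Rightarrow> 'a form" where
  "big_or I f = foldr (\<lambda>i. Or (f i)) (SOME is. set is = I \<and> distinct is) FF"

definition big_and :: "'i set \<Rightarrow> ('i \<Rightarrow> 'a form) \<Rightarrow> 'a form" where
  "big_and I f = foldr (\<lambda>i. And (f i)) (SOME is. set is = I \<and> distinct is) TT"

primrec fv :: "'a form \<Rightarrow> var set" where
  "fv FF = {}"
| "fv (Var X) = {X}"
| "fv (Neg \<phi>) = fv \<phi>"
| "fv (Or \<phi> \<psi>) = fv \<phi> \<union> fv \<psi>"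
| "fv (Dia a \<phi>) = fv \<phi>"
| "fv (Mu X \<phi>) = fv \<phi> - {X}"
| "fv (Nu X \<phi>) = fv \<phi> - {X}"

definition fresh :: "'a form \<Rightarrow> var" where
  "fresh \<phi> = (SOME Y. Y \<notin> fv \<phi>)"

primrec dia :: "'a regular \<Rightarrow> 'a form \<Rightarrow> 'a form" where
  "dia Eps \<phi> = \<phi>"
| "dia (Acts A) \<phi> = big_or A (\<lambda>b. Dia b \<phi>)"
| "dia (Seq R Q) \<phi> = dia R (dia Q \<phi>)"
| "dia (Alt R Q) \<phi> = Or (dia R \<phi>) (dia Q \<phi>)"
| "dia (Star R) \<phi> = Mu (fresh \<phi>) (Or (dia R (Var (fresh \<phi>))) \<phi>)"

definition box :: "'a regular \<Rightarrow> 'a form \<Rightarrow> 'a form" where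
  "box R \<phi> = Neg (dia R (Neg \<phi>))"

end

theory Submission
  imports Defs
begin

text \<open>
  For a state \<open>s\<close> of the argument of the outermost diamond, the greatest fixpoint for a set \<open>F\<close> says
  that \<open>s\<close> lies in a set \<open>T\<close> from each state of which every action of \<open>F\<close> can be taken, by an
  \<open>\<alpha>f\<close>-free path back into \<open>T\<close> through states from which no action of \<open>Act - B - F\<close> is
  \<open>B\<close>-reachable. Taking the actions of \<open>F\<close> in turn for ever gives a strongly hyperfair path. Conversely, on
  an infinite hyperfair path let \<open>F\<close> consist of the relentlessly \<open>B\<close>-reachable actions outside \<open>B\<close>:
  by finiteness the others are unreachable from some point on, each action of \<open>F\<close> occurs again and
  again, and \<open>T\<close> can be the set of states visited from that point on; if \<open>F\<close> is empty these states are
  \<open>B\<close>-locked. The disjunct for \<open>\<alpha>e\<close> relies on feasibility: every state admits a progressing and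
  strongly hyperfair path.
\<close>

section \<open>Words labelling finite runs\<close>

primrec run :: "('s, 'a) lts \<Rightarrow> 's \<Rightarrow> 'a list \<Rightarrow> 's \<Rightarrow> bool" where
  "run M s [] s' \<longleftrightarrow> s = s'"
| "run M s (a # w) s' \<longleftrightarrow> (\<exists>t. (s, a, t) \<in> transitions M \<and> run M t w s')"

lemma run_append: "run M s (u @ v) s' \<longleftrightarrow> (\<exists>t. run M s u t \<and> run M t v s')"
  by (induction u arbitrary: s) auto

lemma finite_lts_transD:
  assumes "finite_lts M" "(s, a, s') \<in> transitions M"
  shows "s \<in> states M" "a \<in> acts M" "s' \<in> states M"
  using assms by (auto simp: finite_lts_def)

lemma run_states:
  assumes "finite_lts M" "run M s w s'" "s \<in> states M"
  shows "s' \<in> states M"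
  using assms(2,3) by (induction w arbitrary: s) (auto dest: finite_lts_transD[OF assms(1)])

lemma run_acts:
  assumes "finite_lts M" "run M s w s'"
  shows "set w \<subseteq> acts M"
  using assms(2) by (induction w arbitrary: s) (auto dest: finite_lts_transD[OF assms(1)])

lemma lang_Star_Acts: "lang (Star (Acts A)) = {w. set w \<subseteq> A}"
proof
  show "lang (Star (Acts A)) \<subseteq> {w. set w \<subseteq> A}"
    by fastforce
  show "{w. set w \<subseteq> A} \<subseteq> lang (Star (Acts A))"
  proof
    fix w assume "w \<in> {w. set w \<subseteq> A}"
    then have "set (map (\<lambda>a. [a]) w) \<subseteq> lang (Acts A)"
      by auto
    moreover have "w = concat (map (\<lambda>a. [a]) w)"
      by (induction w) auto
    ultimately show "w \<in> lang (Star (Acts A))"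
      unfolding lang.simps(5) by blast
  qed
qed

section \<open>Semantics of the derived modalities\<close>

lemma sem_subset_states:
  assumes "\<And>X. e X \<subseteq> states M"
  shows "sem M e \<phi> \<subseteq> states M"
  using assms
proof (induction \<phi> arbitrary: e)
  case (Mu X \<phi>)
  \<comment> \<open>\<open>states M\<close> is itself a pre-fixed point, so the intersection in the
    clause for \<open>Mu\<close> ranges over a nonempty family.\<close>
  have "sem M (e(X := states M)) \<phi> \<subseteq> states M"
    using Mu by simp
  then show ?case
    by auto
qed auto

text \<open>Needed for the star modality: binding a fresh variable around \<open>\<phi>\<close> must
  leave the meaning of \<open>\<phi>\<close> unchanged.\<close>

lemma sem_cong_fv: "(\<And>X. X \<in> fv \<phi> \<Longrightarrow> e X = e' X) \<Longrightarrow> sem M e \<phi> = sem M e' \<phi>"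
proof (induction \<phi> arbitrary: e e')
  case (Or \<phi> \<psi>)
  then show ?case
    by (metis UnCI fv.simps(4) sem.simps(4))
next
  case (Mu X \<phi>)
  have "sem M (e(X := T)) \<phi> = sem M (e'(X := T)) \<phi>" for T
    using Mu.prems by (intro Mu.IH) auto
  then show ?case
    by simp
next
  case (Nu X \<phi>)
  have "sem M (e(X := T)) \<phi> = sem M (e'(X := T)) \<phi>" for T
    using Nu.prems by (intro Nu.IH) auto
  then show ?case
    by simp
next
  case (Neg \<phi>)
  then have "sem M e \<phi> = sem M e' \<phi>"
    by (metis fv.simps(3))
  then show ?case
    by simp
next
  case (Dia a \<phi>)
  then have "sem M e \<phi> = sem M e' \<phi>"
    by (metis fv.simps(5))
  then show ?case
    by simp
qed simp_all

lemma finite_fv: "finite (fv \<phi>)"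
  by (induction \<phi>) auto

lemma fresh_notin_fv: "fresh \<phi> \<notin> fv \<phi>"
proof -
  have "\<exists>Y. Y \<notin> fv \<phi>"
    using ex_new_if_finite[OF infinite_UNIV_listI finite_fv] .
  then show ?thesis
    unfolding fresh_def by (rule someI_ex)
qed

lemma sem_And: "sem M e (And \<phi> \<psi>) = states M \<inter> sem M e \<phi> \<inter> sem M e \<psi>"
  by (auto simp: And_def)

lemma set_SOME_enumeration:
  assumes "finite I"
  shows "set (SOME is. set is = I \<and> distinct is) = I"
  using someI_ex[OF finite_distinct_list[OF assms]] by simp

lemma sem_big_or:
  assumes "finite I"
  shows "sem M e (big_or I f) = (\<Union>i\<in>I. sem M e (f i))"
proof -
  have "sem M e (foldr (\<lambda>i. Or (f i)) is FF) = (\<Union>i\<in>set is. sem M e (f i))" for "is"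
    by (induction "is") auto
  then show ?thesis
    by (simp add: big_or_def set_SOME_enumeration[OF assms])
qed

text \<open>The factor \<open>states M\<close> is the meaning of the empty conjunction
  \<open>TT\<close>; it matters when \<open>I\<close> is empty.\<close>

lemma sem_big_and:
  assumes "finite I"
  shows "sem M e (big_and I f) = states M \<inter> (\<Inter>i\<in>I. sem M e (f i))"
proof -
  have "sem M e (foldr (\<lambda>i. And (f i)) is TT) = states M \<inter> (\<Inter>i\<in>set is. sem M e (f i))" for "is"
    by (induction "is") (auto simp: sem_And TT_def)
  then show ?thesis
    by (simp add: big_and_def set_SOME_enumeration[OF assms])
qed

lemma sem_dia_Acts:
  assumes "finite A"
  shows "sem M e (dia (Acts A) \<phi>) =
    {s \<in> states M. \<exists>a\<in>A. \<exists>s'. (s, a, s') \<in> transitions M \<and> s' \<in> sem M e \<phi>}"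
  by (auto simp: sem_big_or[OF assms])

text \<open>Induction on \<open>R\<close>, for all \<open>\<phi>\<close> and \<open>e\<close>:
  sequencing nests one modality inside another, and the star evaluates its body in an updated
  environment. It reduces all regular modalities to runs labelled by words.\<close>

lemma sem_dia:
  assumes M: "finite_lts M" and "regular_over (acts M) R" and "\<And>X. e X \<subseteq> states M"
  shows "sem M e (dia R \<phi>) = {s \<in> states M. \<exists>w\<in>lang R. \<exists>s'\<in>sem M e \<phi>. run M s w s'}"
  using assms(2,3)
proof (induction R arbitrary: e \<phi>)
  case Eps
  then show ?case
    using sem_subset_states[of e M \<phi>] by auto
next
  case (Acts A)
  then have "finite A"
    using M by (auto simp: finite_lts_def intro: finite_subset)
  then show ?case
    by (fastforce simp: sem_big_or)
next
  case (Seq R Q)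
  then have "sem M e (dia (Seq R Q) \<phi>) = {s \<in> states M. \<exists>u\<in>lang R. \<exists>t\<in>states M.
      run M s u t \<and> (\<exists>v\<in>lang Q. \<exists>s'\<in>sem M e \<phi>. run M t v s')}"
    by auto
  also have "\<dots> = {s \<in> states M. \<exists>u\<in>lang R. \<exists>v\<in>lang Q. \<exists>s'\<in>sem M e \<phi>. run M s (u @ v) s'}"
    unfolding run_append using run_states[OF M] by blast
  also have "\<dots> = {s \<in> states M. \<exists>w\<in>lang (Seq R Q). \<exists>s'\<in>sem M e \<phi>. run M s w s'}"
    unfolding lang.simps(3) by blast
  finally show ?case .
next
  case (Alt R Q)
  then show ?case
    by auto
next
  case (Star R)
  define Y where "Y = fresh \<phi>"
  define S where "S = sem M e \<phi>"
  have S: "S \<subseteq> states M"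
    unfolding S_def using Star.prems(2) by (rule sem_subset_states)
  have \<phi>: "sem M (e(Y := T)) \<phi> = S" for T
    unfolding S_def by (rule sem_cong_fv) (use fresh_notin_fv[of \<phi>] in \<open>auto simp: Y_def\<close>)
  \<comment> \<open>The induction hypothesis at \<open>Var Y\<close>;
    \<open>T \<subseteq> states M\<close> keeps the updated environment inside the state
    set.\<close>
  have R: "sem M (e(Y := T)) (dia R (Var Y)) = {s \<in> states M. \<exists>w\<in>lang R. \<exists>s'\<in>T. run M s w s'}"
    if "T \<subseteq> states M" for T
  proof -
    have "(e(Y := T)) X \<subseteq> states M" for X
      using Star.prems(2) that by simp
    from Star.IH[of "e(Y := T)" "Var Y", OF _ this] Star.prems(1) show ?thesis
      by (simp add: fun_upd_def)
  qed
  define L where "L = {s \<in> states M. \<exists>w\<in>lang (Star R). \<exists>s'\<in>S. run M s w s'}"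
  have "sem M e (dia (Star R) \<phi>) = \<Inter>{T. T \<subseteq> states M \<and> sem M (e(Y := T)) (dia R (Var Y)) \<union> S \<subseteq> T}"
    by (simp add: Y_def[symmetric] \<phi>)
  also have "\<dots> = L"
  proof
    \<comment> \<open>\<open>L\<close> is a pre-fixed point, since a factor from
      \<open>lang R\<close> can be put in front of a star word.\<close>
    have "sem M (e(Y := L)) (dia R (Var Y)) \<subseteq> L"
    proof
      fix s assume "s \<in> sem M (e(Y := L)) (dia R (Var Y))"
      then obtain w s' where s: "s \<in> states M" "w \<in> lang R" "s' \<in> L" "run M s w s'"
        using R[of L] unfolding L_def by blast
      then obtain ws t where "set ws \<subseteq> lang R" "t \<in> S" "run M s' (concat ws) t"
        unfolding L_def by auto
      with s have "set (w # ws) \<subseteq> lang R" "run M s (concat (w # ws)) t"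
        by (auto simp: run_append)
      with s \<open>t \<in> S\<close> show "s \<in> L"
        unfolding L_def lang.simps by blast
    qed
    moreover have "S \<subseteq> L"
      using S unfolding L_def by (force intro: exI[of _ "[]"])
    moreover have "L \<subseteq> states M"
      by (auto simp: L_def)
    ultimately show "\<Inter>{T. T \<subseteq> states M \<and> sem M (e(Y := T)) (dia R (Var Y)) \<union> S \<subseteq> T} \<subseteq> L"
      by blast
    \<comment> \<open>Conversely every pre-fixed point contains \<open>L\<close>: induction on the
      list of factors of the star word, peeling off the first one.\<close>
    have "s \<in> T" if T: "T \<subseteq> states M" "sem M (e(Y := T)) (dia R (Var Y)) \<union> S \<subseteq> T"
      and s: "s \<in> states M" "set ws \<subseteq> lang R" "s' \<in> S" "run M s (concat ws) s'" for T s ws s'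
      using s
    proof (induction ws arbitrary: s)
      case Nil
      then show ?case
        using T by auto
    next
      case (Cons w ws)
      then obtain t where t: "run M s w t" "run M t (concat ws) s'"
        by (auto simp: run_append)
      then have "t \<in> T"
        using Cons run_states[OF M] by simp
      with t Cons.prems T(2) show ?case
        by (auto simp: R[OF T(1)])
    qed
    then show "L \<subseteq> \<Inter>{T. T \<subseteq> states M \<and> sem M (e(Y := T)) (dia R (Var Y)) \<union> S \<subseteq> T}"
      unfolding L_def by auto
  qed
  finally show ?case
    by (simp add: L_def S_def)
qed

section \<open>Paths\<close>

lemma path_drop_path_drop: "path_drop i (path_drop j \<pi>) = path_drop (j + i) \<pi>"
  by (cases "plen \<pi>") (auto simp: path_drop_def add.assoc)

lemma path_drop_simps [simp]:
  "plen (path_drop k \<pi>) = plen \<pi> - enat k"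
  "pstate (path_drop k \<pi>) i = pstate \<pi> (k + i)"
  "ptrans (path_drop k \<pi>) i = ptrans \<pi> (k + i)"
  by (simp_all add: path_drop_def)

lemma path_take_simps [simp]:
  "plen (path_take k \<pi>) = enat k"
  "pstate (path_take k \<pi>) = pstate \<pi>"
  "ptrans (path_take k \<pi>) = ptrans \<pi>"
  by (simp_all add: path_take_def)

lemma less_enat_diff_iff:
  "enat k \<le> n \<Longrightarrow> enat i < n - enat k \<longleftrightarrow> enat (k + i) < n"
  "enat k \<le> n \<Longrightarrow> enat i \<le> n - enat k \<longleftrightarrow> enat (k + i) \<le> n"
  by (cases n; auto)+

lemma is_path_step:
  assumes "is_path M \<pi>" "enat i < plen \<pi>"
  shows "(pstate \<pi> i, label (ptrans \<pi> i), pstate \<pi> (Suc i)) \<in> transitions M"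
  using assms unfolding is_path_def by (metis prod.collapse)

lemma is_path_state:
  assumes "finite_lts M" "is_path M \<pi>" "enat i \<le> plen \<pi>"
  shows "pstate \<pi> i \<in> states M"
proof (cases i)
  case 0
  then show ?thesis
    using assms by (simp add: is_path_def)
next
  case (Suc j)
  then show ?thesis
    using assms is_path_step[OF assms(2), of j] finite_lts_transD(3)[OF assms(1)]
    by (metis Suc_ile_eq)
qed

text \<open>The passage from paths to words. The start \<open>i\<close> is arbitrary because the
  induction on \<open>n\<close> moves it forward.\<close>

lemma path_run:
  assumes "is_path M \<pi>" "enat (i + n) \<le> plen \<pi>"
  shows "run M (pstate \<pi> i) (map (\<lambda>j. label (ptrans \<pi> j)) [i..<i + n]) (pstate \<pi> (i + n))"
  using assms(2)
proof (induction n arbitrary: i)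
  case (Suc n)
  then have "enat i < plen \<pi>"
    by (metis add_Suc_right enat_ord_simps(2) less_add_Suc1 order_less_le_trans)
  with Suc.IH[of "Suc i"] Suc.prems is_path_step[OF assms(1)] show ?case
    by (auto simp: upt_conv_Cons simp del: upt_Suc)
qed simp

section \<open>Prepending transitions and runs to a path\<close>

definition path_Cons :: "'s \<Rightarrow> 'a \<Rightarrow> ('s, 'a) path \<Rightarrow> ('s, 'a) path" where
  "path_Cons s a \<pi> = \<lparr>plen = eSuc (plen \<pi>), pstate = case_nat s (pstate \<pi>),
     ptrans = case_nat (s, a, pstate \<pi> 0) (ptrans \<pi>)\<rparr>"

lemma path_Cons_simps [simp]:
  "plen (path_Cons s a \<pi>) = eSuc (plen \<pi>)"
  "pstate (path_Cons s a \<pi>) 0 = s"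
  "pstate (path_Cons s a \<pi>) (Suc i) = pstate \<pi> i"
  "ptrans (path_Cons s a \<pi>) 0 = (s, a, pstate \<pi> 0)"
  "ptrans (path_Cons s a \<pi>) (Suc i) = ptrans \<pi> i"
  by (simp_all add: path_Cons_def)

lemma is_path_Cons:
  assumes "finite_lts M" "is_path M \<pi>" "(s, a, pstate \<pi> 0) \<in> transitions M"
  shows "is_path M (path_Cons s a \<pi>)"
  unfolding is_path_def
proof (intro conjI allI impI)
  show "pstate (path_Cons s a \<pi>) 0 \<in> states M"
    using finite_lts_transD[OF assms(1,3)] by simp
next
  fix i assume i: "enat i < plen (path_Cons s a \<pi>)"
  show "ptrans (path_Cons s a \<pi>) i \<in> transitions M"
    and "src (ptrans (path_Cons s a \<pi>) i) = pstate (path_Cons s a \<pi>) i"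
    and "tgt (ptrans (path_Cons s a \<pi>) i) = pstate (path_Cons s a \<pi>) (Suc i)"
    using i assms(2,3) by (cases i; auto simp: is_path_def eSuc_enat[symmetric])+
qed

lemma path_drop_Cons: "path_drop (Suc k) (path_Cons s a \<pi>) = path_drop k \<pi>"
  by (cases "plen \<pi>") (auto simp: path_drop_def path_Cons_def eSuc_enat)

lemma path_drop_0 [simp]: "path_drop 0 \<pi> = \<pi>"
  by (cases \<pi>) (auto simp: path_drop_def enat_0)

text \<open>The passage from words back to paths, one transition at a time. The tail is recovered as
  an equality of paths, so properties of \<open>\<pi>\<close> carry over by rewriting.\<close>

lemma ex_path_append:
  assumes "finite_lts M" "run M s w s'" "is_path M \<pi>" "pstate \<pi> 0 = s'"
  shows "\<exists>\<pi>'. is_path M \<pi>' \<and> pstate \<pi>' 0 = s \<and> plen \<pi>' = enat (length w) + plen \<pi>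
    \<and> path_drop (length w) \<pi>' = \<pi> \<and> (\<forall>i<length w. label (ptrans \<pi>' i) = w ! i)"
  using assms(2)
proof (induction w arbitrary: s)
  case Nil
  then show ?case
    using assms by (auto simp: enat_0 intro!: exI[of _ \<pi>])
next
  case (Cons a w)
  then obtain t where t: "(s, a, t) \<in> transitions M" "run M t w s'"
    by auto
  then obtain \<pi>' where \<pi>': "is_path M \<pi>'" "pstate \<pi>' 0 = t" "plen \<pi>' = enat (length w) + plen \<pi>"
    "path_drop (length w) \<pi>' = \<pi>" "\<forall>i<length w. label (ptrans \<pi>' i) = w ! i"
    using Cons.IH by blast
  have "label (ptrans (path_Cons s a \<pi>') i) = (a # w) ! i" if "i < length (a # w)" for i
    using that \<pi>'(5) by (cases i) auto
  moreover have "plen (path_Cons s a \<pi>') = enat (length (a # w)) + plen \<pi>"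
    by (simp add: \<pi>'(3) eSuc_enat[symmetric] iadd_Suc)
  ultimately show ?case
    using t \<pi>' is_path_Cons[OF assms(1)] path_drop_Cons path_Cons_simps(2)
    by (metis length_Cons)
qed

section \<open>One-state paths, and reachability in terms of words\<close>

definition path_single :: "'s \<Rightarrow> ('s, 'a) path" where
  "path_single s = \<lparr>plen = 0, pstate = (\<lambda>_. s), ptrans = undefined\<rparr>"

lemma path_single_simps [simp]:
  "plen (path_single s) = 0" "pstate (path_single s) i = s"
  by (simp_all add: path_single_def)

lemma is_path_single: "s \<in> states M \<Longrightarrow> is_path M (path_single s)"
  by (simp add: is_path_def)

text \<open>The condition \<open>s \<in> states M\<close> has to appear on the right because the
  empty word runs from any value to itself. Backwards, the run is prepended to the one-state path at
  \<open>s'\<close>.\<close>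

lemma state_reachable_iff_run:
  assumes M: "finite_lts M"
  shows "state_reachable M B s s' \<longleftrightarrow> s \<in> states M \<and> (\<exists>w. set w \<inter> B = {} \<and> run M s w s')"
proof
  assume "state_reachable M B s s'"
  then obtain \<pi> n where \<pi>: "is_path M \<pi>" "free_of B \<pi>" "pstate \<pi> 0 = s" "plen \<pi> = enat n" "pstate \<pi> n = s'"
    by (auto simp: state_reachable_def ends_in_def)
  let ?w = "map (\<lambda>j. label (ptrans \<pi> j)) [0..<n]"
  have "run M s ?w s'"
    using path_run[OF \<pi>(1), of 0 n] \<pi> by simp
  moreover have "set ?w \<inter> B = {}"
    using \<pi>(2,4) by (fastforce simp: free_of_def occurs_def)
  moreover have "s \<in> states M"
    using \<pi> by (auto simp: is_path_def)
  ultimately show "s \<in> states M \<and> (\<exists>w. set w \<inter> B = {} \<and> run M s w s')"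
    by blast
next
  assume "s \<in> states M \<and> (\<exists>w. set w \<inter> B = {} \<and> run M s w s')"
  then obtain w where s: "s \<in> states M" and w: "set w \<inter> B = {}" "run M s w s'"
    by blast
  then have "s' \<in> states M"
    using run_states[OF M] by blast
  then obtain \<pi> :: "('a, 'b) path" where \<pi>: "is_path M \<pi>" "pstate \<pi> 0 = s" "plen \<pi> = enat (length w)"
    "path_drop (length w) \<pi> = path_single s'" "\<forall>i<length w. label (ptrans \<pi> i) = w ! i"
    using ex_path_append[OF M w(2) is_path_single] by auto
  have "pstate \<pi> (length w) = s'"
    using path_drop_simps(2)[of "length w" \<pi> 0] by (simp add: \<pi>(4))
  moreover have "free_of B \<pi>"
    using \<pi>(3,5) w(1) nth_mem by (fastforce simp: free_of_def occurs_def)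
  ultimately show "state_reachable M B s s'"
    using \<pi> by (auto simp: state_reachable_def ends_in_def)
qed

lemma action_reachable_iff_run:
  assumes "finite_lts M"
  shows "action_reachable M B s a \<longleftrightarrow>
    s \<in> states M \<and> (\<exists>w s'. set w \<inter> B = {} \<and> run M s w s' \<and> enabled M s' a)"
  by (auto simp: action_reachable_def state_reachable_iff_run[OF assms])

lemma enabled_action_reachable:
  assumes "finite_lts M" "(s, a, s') \<in> transitions M"
  shows "action_reachable M B s a"
  unfolding action_reachable_iff_run[OF assms(1)]
  using assms(2) finite_lts_transD[OF assms] by (force simp: enabled_def intro: exI[of _ "[]"])

section \<open>Fair continuations\<close>

lemma progressing_path_drop:
  assumes "progressing M B (path_drop k \<pi>)" "enat k \<le> plen \<pi>"
  shows "progressing M B \<pi>"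
  using assms by (cases "plen \<pi>") (auto simp: progressing_def ends_in_def)

lemma path_suffixes_path_drop:
  assumes "enat k \<le> plen \<pi>" "\<sigma> \<in> path_suffixes (path_drop k \<pi>)"
  shows "\<sigma> \<in> path_suffixes \<pi>"
  using assms by (auto simp: path_suffixes_def path_drop_path_drop less_enat_diff_iff)

lemma occurs_path_drop:
  assumes "enat k \<le> plen \<pi>" "occurs (path_drop k \<pi>) a"
  shows "occurs \<pi> a"
  using assms by (auto simp: occurs_def less_enat_diff_iff)

text \<open>A suffix of \<open>\<pi>\<close> either lies within the tail from \<open>k\<close> or
  contains that tail. In the second case relentless reachability is inherited by the tail, and the
  occurrence found there is one in the suffix. Hence a finite prefix can be put before a fair
  path.\<close>

lemma strong_hyperfair_path_drop:
  assumes "strong_hyperfair M B (path_drop k \<pi>)" "enat k \<le> plen \<pi>"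
  shows "strong_hyperfair M B \<pi>"
  unfolding strong_hyperfair_def
proof (intro ballI impI)
  fix \<pi>' a assume \<pi>': "\<pi>' \<in> path_suffixes \<pi>" and a: "a \<in> acts M - B"
    and rel: "relentlessly_reachable M B \<pi>' a"
  obtain m where m: "\<pi>' = path_drop m \<pi>" "enat m \<le> plen \<pi>"
    using \<pi>' by (auto simp: path_suffixes_def)
  show "occurs \<pi>' a"
  proof (cases "m \<ge> k")
    case True
    then have "\<pi>' = path_drop (m - k) (path_drop k \<pi>)"
      using m by (simp add: path_drop_path_drop)
    moreover have "enat (m - k) \<le> plen (path_drop k \<pi>)"
      using True m(2) assms(2) by (simp add: less_enat_diff_iff)
    ultimately show ?thesis
      using assms(1) a rel by (auto simp: strong_hyperfair_def path_suffixes_def)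
  next
    case False
    then have k: "path_drop k \<pi> = path_drop (k - m) \<pi>'" "enat (k - m) \<le> plen \<pi>'"
      using m assms(2) by (simp_all add: path_drop_path_drop less_enat_diff_iff)
    then have "relentlessly_reachable M B (path_drop k \<pi>) a"
      using rel path_suffixes_path_drop[OF k(2)] by (auto simp: relentlessly_reachable_def)
    moreover have "path_drop k \<pi> \<in> path_suffixes (path_drop k \<pi>)"
      by (auto simp: path_suffixes_def enat_0 intro!: exI[of _ 0])
    ultimately have "occurs (path_drop k \<pi>) a"
      using assms(1) a by (auto simp: strong_hyperfair_def)
    then show ?thesis
      using occurs_path_drop[OF k(2)] k(1) by simp
  qed
qed

text \<open>Fairness is vacuous: a word outside \<open>B\<close> leading from \<open>s\<close> to an
  action outside \<open>B\<close> would have its first action, or that action itself if the word is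
  empty, enabled in the locked state.\<close>

lemma path_single_fair:
  assumes M: "finite_lts M" and "locked M B s"
  shows "progressing M B (path_single s)" "strong_hyperfair M B (path_single s)"
proof -
  show "progressing M B (path_single s)"
    using assms(2) by (auto simp: progressing_def ends_in_def enat_0 intro!: exI[of _ 0])
  have "\<not> action_reachable M B s a" if "a \<notin> B" for a
  proof
    assume "action_reachable M B s a"
    then obtain w s' where w: "set w \<inter> B = {}" "run M s w s'" "enabled M s' a"
      by (auto simp: action_reachable_iff_run[OF M])
    then show False
      using assms(2) that by (cases w) (auto simp: locked_def enabled_def)
  qed
  moreover have "path_suffixes (path_single s) = {path_single s :: ('a, 'b) path}"
    by (auto simp: path_suffixes_def enat_0_iff intro!: exI[of _ 0])
  ultimately show "strong_hyperfair M B (path_single s)"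
    by (simp add: strong_hyperfair_def relentlessly_reachable_def contains_state_def)
qed

text \<open>On \<open>states M\<close> this is the meaning of the conjunction of box formulae inside
  the least fixpoint. Values outside \<open>states M\<close> belong to it trivially.\<close>

definition unreachable_except :: "('s, 'a) lts \<Rightarrow> 'a set \<Rightarrow> 'a set \<Rightarrow> 's set" where
  "unreachable_except M B F = {s. \<forall>b\<in>(acts M - B) - F. \<not> action_reachable M B s b}"

text \<open>An action outside \<open>B\<close> that is relentlessly reachable on a suffix is
  reachable from some state of it, so it belongs to \<open>F\<close> and recurs for ever.\<close>

lemma strong_hyperfairI:
  assumes "plen \<pi> = \<infinity>"
    and "\<And>i. pstate \<pi> i \<in> unreachable_except M B F"
    and "\<And>a i. a \<in> F \<Longrightarrow> \<exists>j\<ge>i. label (ptrans \<pi> j) = a"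
  shows "strong_hyperfair M B \<pi>"
  unfolding strong_hyperfair_def
proof (intro ballI impI)
  fix \<pi>' a assume \<pi>': "\<pi>' \<in> path_suffixes \<pi>" and a: "a \<in> acts M - B"
    and rel: "relentlessly_reachable M B \<pi>' a"
  obtain m where m: "\<pi>' = path_drop m \<pi>"
    using \<pi>' by (auto simp: path_suffixes_def)
  have "\<pi>' \<in> path_suffixes \<pi>'"
    by (auto simp: path_suffixes_def enat_0 intro!: exI[of _ 0])
  then obtain s where "contains_state \<pi>' s" "action_reachable M B s a"
    using rel by (auto simp: relentlessly_reachable_def)
  then have "a \<in> F"
    using a assms(2) m by (auto simp: contains_state_def unreachable_except_def)
  then obtain j where "j \<ge> m" "label (ptrans \<pi> j) = a"
    using assms(3) by blast
  then show "occurs \<pi>' a"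
    using assms(1) m by (auto simp: occurs_def intro!: exI[of _ "j - m"])
qed

text \<open>The \<open>n\<close>-th approximant of the least fixpoint in \<open>W\<close>, with \<open>T\<close> as the value of \<open>X\<close>.\<close>

primrec visits :: "('s, 'a) lts \<Rightarrow> 'a set \<Rightarrow> 's set \<Rightarrow> 's set \<Rightarrow> 'a \<Rightarrow> nat \<Rightarrow> 's \<Rightarrow> bool" where
  "visits M G P T a 0 s \<longleftrightarrow> s \<in> P \<and> a \<in> G \<and> (\<exists>s'\<in>T. (s, a, s') \<in> transitions M)"
| "visits M G P T a (Suc n) s \<longleftrightarrow>
     s \<in> P \<and> (\<exists>x\<in>G. \<exists>s'. (s, x, s') \<in> transitions M \<and> visits M G P T a n s')"

section \<open>Paths that take the actions of a finite set in turn\<close>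

lemma ex_infinitely_repeating_sequence:
  assumes "finite F" "F \<noteq> {}"
  shows "\<exists>f :: nat \<Rightarrow> 'a. range f \<subseteq> F \<and> (\<forall>a\<in>F. \<forall>m. \<exists>i\<ge>m. f i = a)"
proof -
  obtain xs where xs: "set xs = F"
    using finite_list[OF assms(1)] by blast
  then have pos: "length xs > 0"
    using assms(2) by auto
  \<comment> \<open>Round robin through an enumeration of \<open>F\<close>; position
    \<open>k\<close> returns at every \<open>k + m * length xs\<close>, which is at least
    \<open>m\<close>.\<close>
  let ?f = "\<lambda>i. xs ! (i mod length xs)"
  have "range ?f \<subseteq> F"
    using xs pos by auto
  moreover have "\<exists>i\<ge>m. ?f i = a" if "a \<in> F" for a m
  proof -
    obtain k where "k < length xs" "xs ! k = a"
      using \<open>a \<in> F\<close> xs by (metis in_set_conv_nth)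
    then have "?f (k + m * length xs) = a"
      by simp
    moreover have "m \<le> k + m * length xs"
      using mult_le_mono2[OF Suc_leI[OF pos], of m] by linarith
    ultimately show ?thesis
      by blast
  qed
  ultimately show ?thesis
    by blast
qed

text \<open>The path follows a schedule \<open>g\<close> in which each action of \<open>F\<close>
  recurs. It moves towards the scheduled action along decreasing ranks; taking that action leads
  back into \<open>T\<close>, where the next one is again within reach.\<close>

lemma ex_cyclic_path:
  assumes M: "finite_lts M" and F: "finite F" "F \<noteq> {}"
    and vis: "\<And>t a. t \<in> T \<Longrightarrow> a \<in> F \<Longrightarrow> \<exists>n. visits M G P T a n t"
    and s: "s \<in> T"
  shows "\<exists>\<pi>. is_path M \<pi> \<and> pstate \<pi> 0 = s \<and> plen \<pi> = \<infinity> \<and> (\<forall>i. pstate \<pi> i \<in> P)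
    \<and> (\<forall>i. label (ptrans \<pi> i) \<in> G) \<and> (\<forall>a\<in>F. \<forall>i. \<exists>j\<ge>i. label (ptrans \<pi> j) = a)"
proof -
  obtain g :: "nat \<Rightarrow> 'b" where g: "range g \<subseteq> F" "\<And>a m. a \<in> F \<Longrightarrow> \<exists>i\<ge>m. g i = a"
    using ex_infinitely_repeating_sequence[OF F] by blast
  \<comment> \<open>The rank: the least number of transitions in \<open>G\<close> still to be made
    before \<open>a\<close> can be taken into \<open>T\<close>.\<close>
  define d where "d a t = (LEAST n. visits M G P T a n t)" for a t
  \<comment> \<open>A configuration pairs the current state with the position in the schedule;
    \<open>?Q\<close> says that the scheduled action has a finite rank.\<close>
  let ?Q = "\<lambda>c. \<exists>n. visits M G P T (g (snd c)) n (fst c)"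
  \<comment> \<open>Either the scheduled action is taken and the schedule advances, or the position
    stays and the rank drops.\<close>
  let ?S = "\<lambda>c x c'. x \<in> G \<and> (fst c, x, fst c') \<in> transitions M \<and> fst c \<in> P \<and>
    (x = g (snd c) \<and> snd c' = Suc (snd c) \<or>
     snd c' = snd c \<and> d (g (snd c)) (fst c') < d (g (snd c)) (fst c))"
  have step: "\<exists>c'. ?Q c' \<and> (\<exists>x. ?S c x c')" if Q: "?Q c" for c
  proof -
    obtain t i where c: "c = (t, i)"
      by (cases c)
    have v: "visits M G P T (g i) (d (g i) t) t"
      unfolding d_def using Q c by (auto intro: LeastI_ex)
    show ?thesis
    proof (cases "d (g i) t")
      case 0
      with v obtain t' where "t \<in> P" "g i \<in> G" "t' \<in> T" "(t, g i, t') \<in> transitions M"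
        by auto
      moreover have "\<exists>n. visits M G P T (g (Suc i)) n t'"
        using vis[OF \<open>t' \<in> T\<close>] g(1) by blast
      ultimately show ?thesis
        using c by (intro exI[of _ "(t', Suc i)"]) auto
    next
      case (Suc m)
      with v obtain x t' where x: "t \<in> P" "x \<in> G" "(t, x, t') \<in> transitions M" "visits M G P T (g i) m t'"
        by auto
      then have "d (g i) t' \<le> m"
        unfolding d_def by (intro Least_le)
      then show ?thesis
        using c x Suc by (intro exI[of _ "(t', i)"]) auto
    qed
  qed
  have "?Q (s, 0)"
    using vis[OF s, of "g 0"] g(1) by (simp add: range_subsetD)
  \<comment> \<open>Dependent choice; the clause for \<open>n = 0\<close> pins the first
    configuration to \<open>(s, 0)\<close>.\<close>
  have "\<exists>f. \<forall>n. (?Q (f n) \<and> (n = 0 \<longrightarrow> f n = (s, 0))) \<and> (\<exists>x. ?S (f n) x (f (Suc n)))"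
  proof (rule dependent_nat_choice)
    show "\<exists>c. ?Q c \<and> (0 = 0 \<longrightarrow> c = (s, 0))"
      using \<open>?Q (s, 0)\<close> by (intro exI[of _ "(s, 0)"]) simp
  next
    fix c :: "'a \<times> nat" and n :: nat
    assume "?Q c \<and> (n = 0 \<longrightarrow> c = (s, 0))"
    then have "?Q c"
      by (rule conjunct1)
    from step[OF this] show "\<exists>c'. (?Q c' \<and> (Suc n = 0 \<longrightarrow> c' = (s, 0))) \<and> (\<exists>x. ?S c x c')"
      by (simp only: nat.distinct simp_thms)
  qed
  then obtain f where f: "f 0 = (s, 0)" "\<And>n. \<exists>x. ?S (f n) x (f (Suc n))"
    by auto
  from f(2) obtain x where x: "\<And>n. ?S (f n) (x n) (f (Suc n))"
    by metis
  define st where "st n = fst (f n)" for n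
  define ix where "ix n = snd (f n)" for n
  have x_G: "x n \<in> G" and st_P: "st n \<in> P" and st_step: "(st n, x n, st (Suc n)) \<in> transitions M" for n
    using x[of n] by (auto simp: st_def)
  have ix: "x n = g (ix n) \<and> ix (Suc n) = Suc (ix n) \<or>
     ix (Suc n) = ix n \<and> d (g (ix n)) (st (Suc n)) < d (g (ix n)) (st n)" for n
    using x[of n] by (auto simp: st_def ix_def)
  \<comment> \<open>The rank cannot drop for ever, so the action scheduled at time \<open>k\<close>
    is eventually taken.\<close>
  have once: "\<exists>j\<ge>k. x j = g (ix k) \<and> ix (Suc j) = Suc (ix k)" for k
  proof (induction "d (g (ix k)) (st k)" arbitrary: k rule: less_induct)
    case less
    then show ?case
      using ix[of k] by (metis Suc_leD order_refl)
  qed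
  \<comment> \<open>Iterating \<open>once\<close> shows that no later position of the schedule is
    skipped.\<close>
  have all: "\<exists>j\<ge>k. x j = g i \<and> ix (Suc j) = Suc i" if "ix k \<le> i" for i k
    using that
  proof (induction i rule: dec_induct)
    case base
    then show ?case
      by (rule once)
  next
    case (step i)
    then obtain j where "j \<ge> k" "ix (Suc j) = Suc i"
      by blast
    with once[of "Suc j"] show ?case
      by (metis Suc_leD order_trans)
  qed
  define \<pi> :: "('a, 'b) path" where
    "\<pi> = \<lparr>plen = \<infinity>, pstate = st, ptrans = (\<lambda>n. (st n, x n, st (Suc n)))\<rparr>"
  have "st 0 = s"
    using f(1) by (simp add: st_def)
  then have "is_path M \<pi>"
    using st_step finite_lts_transD(1)[OF M st_step[of 0]] by (auto simp: is_path_def \<pi>_def)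
  moreover have "\<exists>j\<ge>i. x j = a" if "a \<in> F" for a i
    using all[of i] g(2)[OF that, of "ix i"] by blast
  ultimately show ?thesis
    using \<open>st 0 = s\<close> x_G st_P by (intro exI[of _ \<pi>]) (auto simp: \<pi>_def)
qed

text \<open>The rank is the length of \<open>w\<close>. Closure of \<open>T\<close> under
  transitions outside \<open>B\<close> keeps the whole run in \<open>T\<close>, hence in
  \<open>P\<close>, and puts the target of the final \<open>a\<close> into \<open>T\<close> as
  well.\<close>

lemma run_visits:
  assumes M: "finite_lts M" and "run M t w q" "set w \<inter> B = {}" "enabled M q a" "a \<notin> B" "t \<in> T"
    and "T \<subseteq> P" "\<And>t x t'. t \<in> T \<Longrightarrow> x \<notin> B \<Longrightarrow> (t, x, t') \<in> transitions M \<Longrightarrow> t' \<in> T"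
  shows "\<exists>n. visits M (acts M) P T a n t"
  using assms(2,3,6)
proof (induction w arbitrary: t)
  case Nil
  then obtain q' where "(t, a, q') \<in> transitions M"
    using assms(4) by (auto simp: enabled_def)
  then show ?case
    using assms(5,7,8) Nil finite_lts_transD[OF M] by (intro exI[of _ 0]) auto
next
  case (Cons x w)
  then obtain t' where t': "(t, x, t') \<in> transitions M" "run M t' w q"
    by auto
  then obtain n where "visits M (acts M) P T a n t'"
    using Cons assms(8)[OF _ _ t'(1)] by auto
  then show ?case
    using t'(1) Cons.prems assms(7) finite_lts_transD[OF M] by (intro exI[of _ "Suc n"]) auto
qed

text \<open>
  Walk to a state \<open>s'\<close> whose set of \<open>B\<close>-reachable states is minimal. From then on this set never
  changes, so the finitely many actions reachable from \<open>s'\<close> can be taken in turn for ever.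
\<close>

lemma ex_fair_path:
  assumes M: "finite_lts M" and s: "s \<in> states M"
  shows "\<exists>\<pi>. is_path M \<pi> \<and> pstate \<pi> 0 = s \<and> progressing M B \<pi> \<and> strong_hyperfair M B \<pi>"
proof -
  define N where "N t = {t'. \<exists>w. set w \<inter> B = {} \<and> run M t w t'}" for t
  have N_refl: "t \<in> N t" for t
    by (force simp: N_def intro: exI[of _ "[]"])
  have N_trans: "N t' \<subseteq> N t" if t': "t' \<in> N t" for t t'
  proof
    fix r assume "r \<in> N t'"
    then obtain u v where "set u \<inter> B = {}" "run M t u t'" "set v \<inter> B = {}" "run M t' v r"
      using t' by (auto simp: N_def)
    then have "set (u @ v) \<inter> B = {}" "run M t (u @ v) r"
      by (auto simp: run_append)
    then show "r \<in> N t"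
      unfolding N_def by blast
  qed
  have fin_N: "finite (N t)" if "t \<in> states M" for t
    using M run_states[OF M _ that] unfolding N_def finite_lts_def
    by (auto intro: finite_subset[of _ "states M"])
  obtain s' where s': "s' \<in> N s" and min: "\<And>t. t \<in> N s \<Longrightarrow> card (N s') \<le> card (N t)"
    using ex_has_least_nat[of "\<lambda>t. t \<in> N s" s "\<lambda>t. card (N t)"] N_refl by blast
  obtain w where w: "run M s w s'"
    using s' by (auto simp: N_def)
  have s'_st: "s' \<in> states M"
    using run_states[OF M w s] .
  \<comment> \<open>\<open>N t\<close> is a subset of the finite set \<open>N s'\<close> by
    transitivity, and minimality rules out a smaller cardinality.\<close>
  have N_eq: "N t = N s'" if "t \<in> N s'" for t
    using that min N_trans[OF s'] N_trans[OF that] fin_N[OF s'_st] by (intro card_seteq) auto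
  have "\<exists>\<pi>. is_path M \<pi> \<and> pstate \<pi> 0 = s' \<and> progressing M B \<pi> \<and> strong_hyperfair M B \<pi>"
  proof (cases "locked M B s'")
    case True
    then show ?thesis
      using path_single_fair[OF M True] is_path_single[OF s'_st]
      by (intro exI[of _ "path_single s'"]) auto
  next
    case False
    define F where "F = {a \<in> acts M - B. action_reachable M B s' a}"
    define P where "P = unreachable_except M B F"
    have "F \<noteq> {}"
      using False enabled_action_reachable[OF M] finite_lts_transD(2)[OF M]
      by (fastforce simp: F_def locked_def enabled_def)
    have "finite F"
      using M by (simp add: F_def finite_lts_def)
    \<comment> \<open>What is reachable from a state of \<open>N s'\<close> is reachable from
      \<open>s'\<close>, so nothing outside \<open>F\<close> is.\<close>
    have N_P: "N s' \<subseteq> P"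
    proof
      fix t assume t: "t \<in> N s'"
      have "action_reachable M B s' b" if "action_reachable M B t b" for b
      proof -
        from that obtain v q where v: "set v \<inter> B = {}" "run M t v q" "enabled M q b"
          by (auto simp: action_reachable_iff_run[OF M])
        then have "q \<in> N s'"
          using N_trans[OF t] by (auto simp: N_def)
        then show ?thesis
          using v(3) s'_st by (auto simp: N_def action_reachable_iff_run[OF M])
      qed
      then show "t \<in> P"
        by (auto simp: P_def unreachable_except_def F_def)
    qed
    have "\<exists>n. visits M (acts M) P (N s') a n t" if t: "t \<in> N s'" and a: "a \<in> F" for t a
    proof -
      obtain v q where v: "set v \<inter> B = {}" "run M s' v q" "enabled M q a"
        using a by (auto simp: F_def action_reachable_iff_run[OF M])
      \<comment> \<open>Here minimality is used: \<open>t\<close> can still reach the state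
        \<open>q\<close> in which \<open>a\<close> is enabled.\<close>
      then have "q \<in> N t"
        using N_eq[OF t] by (auto simp: N_def)
      then obtain u where u: "set u \<inter> B = {}" "run M t u q"
        by (auto simp: N_def)
      show ?thesis
      proof (rule run_visits[OF M u(2,1) v(3) _ t N_P])
        show "a \<notin> B"
          using a by (simp add: F_def)
        fix r x r' assume "r \<in> N s'" "x \<notin> B" "(r, x, r') \<in> transitions M"
        then have "set [x] \<inter> B = {}" "run M r [x] r'"
          by auto
        then have "r' \<in> N r"
          unfolding N_def by blast
        then show "r' \<in> N s'"
          using N_eq[OF \<open>r \<in> N s'\<close>] by simp
      qed
    qed
    then obtain \<pi> where \<pi>: "is_path M \<pi>" "pstate \<pi> 0 = s'" "plen \<pi> = \<infinity>" "\<forall>i. pstate \<pi> i \<in> P"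
      "\<forall>a\<in>F. \<forall>i. \<exists>j\<ge>i. label (ptrans \<pi> j) = a"
      using ex_cyclic_path[OF M \<open>finite F\<close> \<open>F \<noteq> {}\<close>, of "N s'" "acts M" P s'] N_refl by blast
    then have "strong_hyperfair M B \<pi>"
      using strong_hyperfairI[of \<pi> M B F] by (auto simp: P_def)
    with \<pi> show ?thesis
      by (auto simp: progressing_def)
  qed
  then obtain \<pi> where \<pi>: "is_path M \<pi>" "pstate \<pi> 0 = s'" "progressing M B \<pi>" "strong_hyperfair M B \<pi>"
    by blast
  obtain \<pi>' where \<pi>': "is_path M \<pi>'" "pstate \<pi>' 0 = s" "plen \<pi>' = enat (length w) + plen \<pi>"
    "path_drop (length w) \<pi>' = \<pi>"
    using ex_path_append[OF M w \<pi>(1,2)] by blast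
  have "enat (length w) \<le> plen \<pi>'"
    by (simp add: \<pi>'(3))
  then show ?thesis
    using \<pi>' \<pi> progressing_path_drop[of M B "length w" \<pi>'] strong_hyperfair_path_drop[of M B "length w" \<pi>']
    by auto
qed

section \<open>The fixpoint formula\<close>

text \<open>The words of the regular formula are those over \<open>acts M - B\<close> followed by
  \<open>b\<close>. Since labels of runs lie in \<open>acts M\<close>, such a run is exactly a
  \<open>B\<close>-free run to a state enabling \<open>b\<close>, followed by a
  \<open>b\<close>-transition.\<close>

lemma sem_box_unreachable:
  assumes M: "finite_lts M" and "b \<in> acts M" and e: "\<And>X. e X \<subseteq> states M"
  shows "sem M e (box (Seq (Star (Acts (acts M - B))) (Acts {b})) FF) =
    {s \<in> states M. \<not> action_reachable M B s b}"
proof -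
  have "sem M e (dia (Seq (Star (Acts (acts M - B))) (Acts {b})) (Neg FF)) =
      {s \<in> states M. \<exists>w\<in>lang (Seq (Star (Acts (acts M - B))) (Acts {b})). \<exists>s'\<in>states M. run M s w s'}"
    using sem_dia[OF M, of "Seq (Star (Acts (acts M - B))) (Acts {b})" e "Neg FF"] assms(2) e
    by (simp del: dia.simps lang.simps)
  also have "\<dots> = {s \<in> states M. action_reachable M B s b}"
  proof -
    have "(\<exists>w\<in>lang (Seq (Star (Acts (acts M - B))) (Acts {b})). \<exists>s'\<in>states M. run M s w s') \<longleftrightarrow>
        (\<exists>w s'. set w \<inter> B = {} \<and> run M s w s' \<and> enabled M s' b)" (is "?l \<longleftrightarrow> ?r") for s
    proof
      assume ?l
      then show ?r
        unfolding lang.simps(3) lang_Star_Acts by (fastforce simp: run_append enabled_def)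
    next
      assume ?r
      then obtain w t s' where w: "set w \<inter> B = {}" "run M s w t" "(t, b, s') \<in> transitions M"
        by (auto simp: enabled_def)
      then have "w @ [b] \<in> lang (Seq (Star (Acts (acts M - B))) (Acts {b}))"
        unfolding lang.simps(3) lang_Star_Acts using run_acts[OF M w(2)] by auto
      moreover have "run M s (w @ [b]) s'"
        using w by (auto simp: run_append)
      ultimately show ?l
        using finite_lts_transD(3)[OF M w(3)] by blast
    qed
    then show ?thesis
      by (auto simp: action_reachable_iff_run[OF M])
  qed
  finally show ?thesis
    by (auto simp: box_def simp del: dia.simps)
qed

lemma sem_box_locked:
  assumes M: "finite_lts M"
  shows "sem M e (box (Acts (acts M - B)) FF) = {s \<in> states M. locked M B s}"
proof -
  have "finite (acts M - B)"
    using M by (simp add: finite_lts_def)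
  then show ?thesis
    using finite_lts_transD[OF M]
    by (fastforce simp: box_def sem_dia_Acts locked_def enabled_def simp del: dia.simps)
qed

abbreviation body :: "('s, 'a) lts \<Rightarrow> 'a set \<Rightarrow> 'a set \<Rightarrow> 'a set \<Rightarrow> 'a \<Rightarrow> 'a form" where
  "body M B \<alpha>f F a \<equiv> And
    (big_and ((acts M - B) - F) (\<lambda>b. box (Seq (Star (Acts (acts M - B))) (Acts {b})) FF))
    (Or (dia (Acts ({a} - \<alpha>f)) (Var ''X'')) (dia (Acts (acts M - \<alpha>f)) (Var ''W'')))"

lemma sem_body:
  assumes M: "finite_lts M" and a: "a \<in> acts M" and e: "\<And>X. e X \<subseteq> states M"
  shows "sem M e (body M B \<alpha>f F a) = {s \<in> states M. s \<in> unreachable_except M B F \<and>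
    (a \<in> acts M - \<alpha>f \<and> (\<exists>s'\<in>e ''X''. (s, a, s') \<in> transitions M) \<or>
     (\<exists>x\<in>acts M - \<alpha>f. \<exists>s'\<in>e ''W''. (s, x, s') \<in> transitions M))}"
proof -
  have fin: "finite ((acts M - B) - F)" "finite (acts M - \<alpha>f)" "finite ({a} - \<alpha>f)"
    using M by (auto simp: finite_lts_def)
  have "sem M e (big_and ((acts M - B) - F) (\<lambda>b. box (Seq (Star (Acts (acts M - B))) (Acts {b})) FF))
    = states M \<inter> unreachable_except M B F"
    unfolding sem_big_and[OF fin(1)] using sem_box_unreachable[OF M _ e]
    by (auto simp: unreachable_except_def)
  then show ?thesis
    unfolding sem_And sem.simps(4) sem_dia_Acts[OF fin(2)] sem_dia_Acts[OF fin(3)]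
    using a by auto
qed

text \<open>Identifies the least fixpoint as a pre-fixed point below all others, which avoids a
  monotonicity argument.\<close>

lemma sem_Mu_eqI:
  assumes "L \<subseteq> states M" "sem M (e(X := L)) \<phi> \<subseteq> L"
    and "\<And>U. U \<subseteq> states M \<Longrightarrow> sem M (e(X := U)) \<phi> \<subseteq> U \<Longrightarrow> L \<subseteq> U"
  shows "sem M e (Mu X \<phi>) = L"
  unfolding sem.simps(6) using assms by blast

text \<open>The states with a finite rank form a pre-fixed point: the disjunct for \<open>X\<close>
  gives rank 0 and the one for \<open>W\<close> a successor. Induction on the rank places them in
  every pre-fixed point.\<close>

lemma sem_Mu_body:
  assumes M: "finite_lts M" and a: "a \<in> acts M" and e: "\<And>X. e X \<subseteq> states M"
  shows "sem M e (Mu ''W'' (body M B \<alpha>f F a)) =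
    {s \<in> states M. \<exists>n. visits M (acts M - \<alpha>f) (unreachable_except M B F) (e ''X'') a n s}"
    (is "_ = {s \<in> states M. \<exists>n. ?v n s}")
proof (rule sem_Mu_eqI)
  let ?L = "{s \<in> states M. \<exists>n. ?v n s}"
  have b: "sem M (e(''W'' := U)) (body M B \<alpha>f F a) = {s \<in> states M. s \<in> unreachable_except M B F \<and>
    (a \<in> acts M - \<alpha>f \<and> (\<exists>s'\<in>e ''X''. (s, a, s') \<in> transitions M) \<or>
     (\<exists>x\<in>acts M - \<alpha>f. \<exists>s'\<in>U. (s, x, s') \<in> transitions M))}" if "U \<subseteq> states M" for U
    using sem_body[OF M a, of "e(''W'' := U)"] e that by simp
  show "?L \<subseteq> states M"
    by blast
  show "sem M (e(''W'' := ?L)) (body M B \<alpha>f F a) \<subseteq> ?L"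
  proof
    fix s assume "s \<in> sem M (e(''W'' := ?L)) (body M B \<alpha>f F a)"
    then have s: "s \<in> states M" "s \<in> unreachable_except M B F"
      "a \<in> acts M - \<alpha>f \<and> (\<exists>s'\<in>e ''X''. (s, a, s') \<in> transitions M) \<or>
       (\<exists>x\<in>acts M - \<alpha>f. \<exists>s'\<in>?L. (s, x, s') \<in> transitions M)"
      using b[of ?L] by blast+
    from s(3) have "?v 0 s \<or> (\<exists>n. ?v (Suc n) s)"
      using s(2) by auto
    with s(1) show "s \<in> ?L"
      by blast
  qed
  have "s \<in> U" if U: "U \<subseteq> states M" "sem M (e(''W'' := U)) (body M B \<alpha>f F a) \<subseteq> U"
    and "?v n s" for U s n
    using that(3)
  proof (induction n arbitrary: s)
    case 0
    then show ?case
      using U(2) finite_lts_transD(1)[OF M] unfolding b[OF U(1)] by auto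
  next
    case (Suc n)
    then show ?case
      using U(2) finite_lts_transD(1)[OF M] unfolding b[OF U(1)] by auto
  qed
  then show "?L \<subseteq> U" if "U \<subseteq> states M" "sem M (e(''W'' := U)) (body M B \<alpha>f F a) \<subseteq> U" for U
    using that by blast
qed

text \<open>The sets \<open>T\<close> on the right are the post-fixed points whose union is the
  greatest fixpoint, with \<open>sem_Mu_body\<close> evaluated at \<open>T\<close> as the value of
  \<open>X\<close>.\<close>

lemma sem_Nu_body:
  assumes M: "finite_lts M" and F: "F \<subseteq> acts M" and e: "\<And>X. e X \<subseteq> states M"
  shows "s \<in> sem M e (Nu ''X'' (big_and F (\<lambda>a. Mu ''W'' (body M B \<alpha>f F a)))) \<longleftrightarrow>
    (\<exists>T\<subseteq>states M. s \<in> T \<and>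
      (\<forall>t\<in>T. \<forall>a\<in>F. \<exists>n. visits M (acts M - \<alpha>f) (unreachable_except M B F) T a n t))"
proof -
  have fin: "finite F"
    using M F by (auto simp: finite_lts_def intro: finite_subset)
  have iff: "T \<subseteq> sem M (e(''X'' := T)) (big_and F (\<lambda>a. Mu ''W'' (body M B \<alpha>f F a))) \<longleftrightarrow>
    (\<forall>t\<in>T. \<forall>a\<in>F. \<exists>n. visits M (acts M - \<alpha>f) (unreachable_except M B F) T a n t)"
    if T: "T \<subseteq> states M" for T
  proof -
    have "sem M (e(''X'' := T)) (Mu ''W'' (body M B \<alpha>f F a)) =
      {s \<in> states M. \<exists>n. visits M (acts M - \<alpha>f) (unreachable_except M B F) T a n s}" if "a \<in> F" for a
    proof -
      have a: "a \<in> acts M" and e': "(e(''X'' := T)) X \<subseteq> states M" for X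
        using F that e T by auto
      show ?thesis
        unfolding sem_Mu_body[OF M a e'] by simp
    qed
    then show ?thesis
      unfolding sem_big_and[OF fin] using T by blast
  qed
  \<comment> \<open>Reorders the conjuncts under the existential so that \<open>iff\<close> can be
    applied with its assumption \<open>T \<subseteq> states M\<close> at hand.\<close>
  have conj: "(P \<Longrightarrow> Q = R) \<Longrightarrow> ((P \<and> Q) \<and> S) = (P \<and> S \<and> R)" for P Q R S
    by blast
  show ?thesis
    unfolding sem.simps(7) Union_iff Bex_def mem_Collect_eq by (intro ex_cong1 conj iff)
qed

section \<open>Violating paths and the formula\<close>

abbreviation goal :: "('s, 'a) lts \<Rightarrow> 'a set \<Rightarrow> 'a set \<Rightarrow> 'a set \<Rightarrow> 'a form" where
  "goal M B \<alpha>f \<alpha>e \<equiv> Or (dia (Acts \<alpha>e) TT)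
    (Or (box (Acts (acts M - B)) FF)
        (big_or {F. F \<noteq> {} \<and> F \<subseteq> acts M - B} (\<lambda>F.
           Nu ''X'' (big_and F (\<lambda>a. Mu ''W'' (body M B \<alpha>f F a))))))"

lemma sem_goal:
  assumes M: "finite_lts M" and \<alpha>e: "\<alpha>e \<subseteq> acts M" and s: "s \<in> states M"
  shows "s \<in> sem M (\<lambda>_. {}) (goal M B \<alpha>f \<alpha>e) \<longleftrightarrow>
    (\<exists>a\<in>\<alpha>e. \<exists>s'. (s, a, s') \<in> transitions M) \<or> locked M B s \<or>
    (\<exists>F T. F \<noteq> {} \<and> F \<subseteq> acts M - B \<and> T \<subseteq> states M \<and> s \<in> T \<and>
      (\<forall>t\<in>T. \<forall>a\<in>F. \<exists>n. visits M (acts M - \<alpha>f) (unreachable_except M B F) T a n t))"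
proof -
  have fin: "finite \<alpha>e" "finite {F. F \<noteq> {} \<and> F \<subseteq> acts M - B}"
    using M \<alpha>e by (auto simp: finite_lts_def intro: finite_subset)
  have exit: "s \<in> sem M (\<lambda>_. {}) (dia (Acts \<alpha>e) TT) \<longleftrightarrow> (\<exists>a\<in>\<alpha>e. \<exists>s'. (s, a, s') \<in> transitions M)"
    unfolding sem_dia_Acts[OF fin(1)] TT_def using s finite_lts_transD[OF M] by auto blast
  have cycle: "s \<in> sem M (\<lambda>_. {}) (big_or {F. F \<noteq> {} \<and> F \<subseteq> acts M - B} (\<lambda>F.
           Nu ''X'' (big_and F (\<lambda>a. Mu ''W'' (body M B \<alpha>f F a))))) \<longleftrightarrow>
    (\<exists>F. F \<noteq> {} \<and> F \<subseteq> acts M - B \<and> (\<exists>T\<subseteq>states M. s \<in> T \<and>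
      (\<forall>t\<in>T. \<forall>a\<in>F. \<exists>n. visits M (acts M - \<alpha>f) (unreachable_except M B F) T a n t)))"
  proof -
    have "s \<in> sem M (\<lambda>_. {}) (Nu ''X'' (big_and F (\<lambda>a. Mu ''W'' (body M B \<alpha>f F a)))) \<longleftrightarrow>
      (\<exists>T\<subseteq>states M. s \<in> T \<and>
      (\<forall>t\<in>T. \<forall>a\<in>F. \<exists>n. visits M (acts M - \<alpha>f) (unreachable_except M B F) T a n t))"
      if "F \<subseteq> acts M - B" for F
      using that by (intro sem_Nu_body[OF M]) auto
    then show ?thesis
      unfolding sem_big_or[OF fin(2)] UN_iff Bex_def mem_Collect_eq conj_assoc
      by (intro ex_cong1 conj_cong refl)
  qed
  show ?thesis
    unfolding sem.simps(4) sem_box_locked[OF M] Un_iff mem_Collect_eq exit cycle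
    using s by (simp only: ex_simps simp_thms)
qed

text \<open>A word of the outer modality splits into \<open>u\<close> matching \<open>\<rho>\<close>
  and an \<open>\<alpha>f\<close>-free \<open>v\<close>; all labels of a run are actions of
  \<open>M\<close>, so avoiding \<open>\<alpha>f\<close> suffices for \<open>v\<close>.\<close>

lemma satisfies_iff_run:
  assumes M: "finite_lts M" and "regular_over (acts M) \<rho>"
  shows "satisfies M (Neg (dia (Seq \<rho> (Star (Acts (acts M - \<alpha>f)))) \<phi>)) \<longleftrightarrow>
    \<not> (\<exists>u v s'. u \<in> lang \<rho> \<and> set v \<inter> \<alpha>f = {} \<and> run M (init M) (u @ v) s' \<and> s' \<in> sem M (\<lambda>_. {}) \<phi>)"
proof -
  let ?R = "Seq \<rho> (Star (Acts (acts M - \<alpha>f)))"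
  have "init M \<in> states M"
    using M by (simp add: finite_lts_def)
  moreover have "sem M (\<lambda>_. {}) (dia ?R \<phi>) =
      {s \<in> states M. \<exists>w\<in>lang ?R. \<exists>s'\<in>sem M (\<lambda>_. {}) \<phi>. run M s w s'}"
    using assms by (intro sem_dia) auto
  moreover have "(\<exists>w\<in>lang ?R. \<exists>s'\<in>sem M (\<lambda>_. {}) \<phi>. run M (init M) w s') \<longleftrightarrow>
      (\<exists>u v s'. u \<in> lang \<rho> \<and> set v \<inter> \<alpha>f = {} \<and> run M (init M) (u @ v) s' \<and> s' \<in> sem M (\<lambda>_. {}) \<phi>)"
    unfolding lang.simps(3) lang_Star_Acts using run_acts[OF M] by fastforce
  ultimately show ?thesis
    unfolding satisfies_def sem.simps(3) by blast
qed

text \<open>A finite path ends in a locked state. On an infinite one the fixpoint disjunct, or the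
  lock if \<open>F\<close> is empty, may hold only after some delay, which the
  \<open>\<alpha>f\<close>-free part of the outer modality absorbs.\<close>

lemma goal_of_fair_free_path:
  assumes M: "finite_lts M" and \<pi>: "is_path M \<pi>" "progressing M B \<pi>" "strong_hyperfair M B \<pi>"
    and \<alpha>e: "\<alpha>e \<subseteq> acts M" and k: "enat k \<le> plen \<pi>" and free: "free_of \<alpha>f (path_drop k \<pi>)"
  shows "\<exists>m\<ge>k. enat m \<le> plen \<pi> \<and> pstate \<pi> m \<in> sem M (\<lambda>_. {}) (goal M B \<alpha>f \<alpha>e)"
proof (cases "plen \<pi>")
  case (enat n)
  then have "locked M B (pstate \<pi> n)"
    using \<pi>(2) by (auto simp: progressing_def ends_in_def)
  moreover have "pstate \<pi> n \<in> states M"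
    using is_path_state[OF M \<pi>(1)] enat by simp
  ultimately show ?thesis
    using k enat sem_goal[OF M \<alpha>e, of "pstate \<pi> n"] by (intro exI[of _ n] conjI) auto
next
  case infinity
  have step: "(pstate \<pi> i, label (ptrans \<pi> i), pstate \<pi> (Suc i)) \<in> transitions M" for i
    using is_path_step[OF \<pi>(1)] infinity by simp
  define F where "F = {a \<in> acts M - B. relentlessly_reachable M B \<pi> a}"
  define P where "P = unreachable_except M B F"
  \<comment> \<open>If \<open>b\<close> is not relentlessly reachable, some suffix has no state from
    which it is reachable.\<close>
  have "\<exists>m. \<forall>i\<ge>m. \<not> action_reachable M B (pstate \<pi> i) b" if b: "b \<in> (acts M - B) - F" for b
  proof -
    obtain m where m: "\<not> (\<exists>s. contains_state (path_drop m \<pi>) s \<and> action_reachable M B s b)"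
      using b by (auto simp: F_def relentlessly_reachable_def path_suffixes_def)
    have "contains_state (path_drop m \<pi>) (pstate \<pi> i)" if "i \<ge> m" for i
      using that infinity by (auto simp: contains_state_def intro!: exI[of _ "i - m"])
    with m show ?thesis
      by blast
  qed
  then obtain m where m: "\<And>b i. b \<in> (acts M - B) - F \<Longrightarrow> i \<ge> m b \<Longrightarrow> \<not> action_reachable M B (pstate \<pi> i) b"
    by metis
  \<comment> \<open>Beyond all of the finitely many thresholds, and not before \<open>k\<close>, so
    that the path is also \<open>\<alpha>f\<close>-free from \<open>N\<close> on.\<close>
  define N where "N = Max (insert k (m ` ((acts M - B) - F)))"
  have fin: "finite (insert k (m ` ((acts M - B) - F)))"
    using M by (simp add: finite_lts_def)
  have "k \<le> N" and mN: "\<And>b. b \<in> (acts M - B) - F \<Longrightarrow> m b \<le> N"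
    unfolding N_def using fin by (auto intro: Max_ge)
  have P: "pstate \<pi> i \<in> P" if "i \<ge> N" for i
    unfolding P_def unreachable_except_def using m mN that by (blast intro: order_trans)
  have not_\<alpha>f: "label (ptrans \<pi> i) \<in> acts M - \<alpha>f" if "i \<ge> N" for i
  proof -
    have "label (ptrans \<pi> i) \<notin> \<alpha>f"
      using free infinity \<open>k \<le> N\<close> that
      by (auto simp: free_of_def occurs_def dest!: bspec spec[of _ "i - k"])
    with finite_lts_transD(2)[OF M step] show ?thesis
      by simp
  qed
  have N_st: "pstate \<pi> i \<in> states M" for i
    using is_path_state[OF M \<pi>(1)] infinity by simp
  have "pstate \<pi> N \<in> sem M (\<lambda>_. {}) (goal M B \<alpha>f \<alpha>e)"
  proof (cases "F = {}")
    case True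
    have "locked M B (pstate \<pi> N)"
      unfolding locked_def
    proof (intro allI impI)
      fix a assume "enabled M (pstate \<pi> N) a"
      then obtain t where t: "(pstate \<pi> N, a, t) \<in> transitions M"
        by (auto simp: enabled_def)
      then show "a \<in> B"
        using P[of N] True enabled_action_reachable[OF M t] finite_lts_transD(2)[OF M t]
        by (auto simp: P_def unreachable_except_def)
    qed
    then show ?thesis
      unfolding sem_goal[OF M \<alpha>e N_st] by blast
  next
    case False
    define T where "T = pstate \<pi> ` {N..}"
    \<comment> \<open>The path itself witnesses the rank: \<open>n\<close> is the distance to an
      occurrence of \<open>a\<close>, and every state from \<open>N\<close> on lies in both
      \<open>P\<close> and \<open>T\<close>.\<close>
    have v: "visits M (acts M - \<alpha>f) P T a n (pstate \<pi> i)"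
      if "i \<ge> N" "label (ptrans \<pi> (i + n)) = a" for a n i
      using that
    proof (induction n arbitrary: i)
      case 0
      then show ?case
        using P step[of i] not_\<alpha>f[of i] by (auto simp: T_def intro!: bexI[of _ "pstate \<pi> (Suc i)"])
    next
      case (Suc n)
      then show ?case
        using P[of i] step[of i] not_\<alpha>f[of i] Suc.prems Suc.IH[of "Suc i"]
        by (auto intro!: bexI[of _ "label (ptrans \<pi> i)"])
    qed
    have "\<exists>n. visits M (acts M - \<alpha>f) P T a n t" if "t \<in> T" "a \<in> F" for t a
    proof -
      obtain i where i: "t = pstate \<pi> i" "i \<ge> N"
        using \<open>t \<in> T\<close> by (auto simp: T_def)
      \<comment> \<open>Relentless reachability passes to suffixes, so fairness yields an occurrence
        of \<open>a\<close> after every position \<open>i\<close>.\<close>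
      have "relentlessly_reachable M B (path_drop i \<pi>) a"
        using \<open>a \<in> F\<close> path_suffixes_path_drop[of i \<pi>] infinity
        by (auto simp: F_def relentlessly_reachable_def)
      then have "occurs (path_drop i \<pi>) a"
        using \<pi>(3) \<open>a \<in> F\<close> infinity by (auto simp: strong_hyperfair_def path_suffixes_def F_def)
      then show ?thesis
        using v i by (auto simp: occurs_def)
    qed
    moreover have "T \<subseteq> states M" "pstate \<pi> N \<in> T" "F \<subseteq> acts M - B"
      using N_st by (auto simp: T_def F_def)
    ultimately have "\<exists>F T. F \<noteq> {} \<and> F \<subseteq> acts M - B \<and> T \<subseteq> states M \<and> pstate \<pi> N \<in> T \<and>
      (\<forall>t\<in>T. \<forall>a\<in>F. \<exists>n. visits M (acts M - \<alpha>f) (unreachable_except M B F) T a n t)"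
      using False unfolding P_def by blast
    then show ?thesis
      unfolding sem_goal[OF M \<alpha>e N_st] by blast
  qed
  then show ?thesis
    using \<open>k \<le> N\<close> infinity by (auto intro!: exI[of _ N] simp del: sem.simps)
qed

text \<open>Any occurrence of \<open>\<alpha>e\<close> after an \<open>\<alpha>f\<close>-free
  stretch is enough: moving to the least such position only shortens the stretch.\<close>

lemma violating_first:
  assumes "enat k \<le> plen \<pi>" "matches (path_take k \<pi>) \<rho>"
    and "enat j < plen (path_drop k \<pi>)" "label (ptrans (path_drop k \<pi>) j) \<in> \<alpha>e"
    and "free_of \<alpha>f (path_take j (path_drop k \<pi>))"
  shows "violating \<rho> \<alpha>f \<alpha>e \<pi>"
proof -
  let ?l = "\<lambda>j. label (ptrans (path_drop k \<pi>) j)"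
  define i where "i = (LEAST i. ?l i \<in> \<alpha>e)"
  have i: "?l i \<in> \<alpha>e" "i \<le> j" "\<And>i'. i' < i \<Longrightarrow> ?l i' \<notin> \<alpha>e"
    unfolding i_def
    using assms(4) LeastI[of "\<lambda>i. ?l i \<in> \<alpha>e" j] Least_le[of "\<lambda>i. ?l i \<in> \<alpha>e" j]
      not_less_Least[of _ "\<lambda>i. ?l i \<in> \<alpha>e"] by blast+
  have "enat i < plen (path_drop k \<pi>)"
    using i(2) assms(3) by (meson enat_ord_simps(1) order_le_less_trans)
  moreover have "free_of \<alpha>e (path_take i (path_drop k \<pi>))"
    using i(3) by (auto simp: free_of_def occurs_def)
  moreover have "free_of \<alpha>f (path_take i (path_drop k \<pi>))"
    using assms(5) i(2) by (fastforce simp: free_of_def occurs_def)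
  ultimately show ?thesis
    unfolding violating_def Let_def using assms(1,2) i(1) by blast
qed

text \<open>One path per disjunct: an \<open>\<alpha>e\<close>-transition with an arbitrary fair
  continuation, the one-state path at a locked state, or the cyclic path with all labels in
  \<open>acts M - \<alpha>f\<close>.\<close>

lemma ex_fair_path_of_goal:
  assumes M: "finite_lts M" and \<alpha>e: "\<alpha>e \<subseteq> acts M" and s: "s \<in> states M"
    and sem: "s \<in> sem M (\<lambda>_. {}) (goal M B \<alpha>f \<alpha>e)"
  shows "\<exists>\<pi>. is_path M \<pi> \<and> pstate \<pi> 0 = s \<and> progressing M B \<pi> \<and> strong_hyperfair M B \<pi>
    \<and> (free_of \<alpha>f \<pi> \<or> 0 < plen \<pi> \<and> label (ptrans \<pi> 0) \<in> \<alpha>e)"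
  using sem unfolding sem_goal[OF M \<alpha>e s]
proof (elim disjE bexE exE conjE)
  fix a s' assume exit: "a \<in> \<alpha>e" "(s, a, s') \<in> transitions M"
  then obtain \<pi> where \<pi>: "is_path M \<pi>" "pstate \<pi> 0 = s'" "progressing M B \<pi>" "strong_hyperfair M B \<pi>"
    using ex_fair_path[OF M] finite_lts_transD(3)[OF M] by blast
  have d: "path_drop 1 (path_Cons s a \<pi>) = \<pi>" "enat 1 \<le> plen (path_Cons s a \<pi>)"
    using path_drop_Cons[of 0 s a \<pi>] by (simp, cases "plen \<pi>", auto simp: eSuc_enat)
  show ?thesis
    using exit \<pi> d is_path_Cons[OF M \<pi>(1)] progressing_path_drop[OF _ d(2)]
      strong_hyperfair_path_drop[OF _ d(2)]
    by (intro exI[of _ "path_Cons s a \<pi>"]) auto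
next
  assume lock: "locked M B s"
  then show ?thesis
    using path_single_fair[OF M lock] is_path_single[OF s]
    by (intro exI[of _ "path_single s"]) (auto simp: free_of_def occurs_def)
next
  fix F T assume cycle: "F \<noteq> {}" "F \<subseteq> acts M - B" "T \<subseteq> states M" "s \<in> T"
    "\<forall>t\<in>T. \<forall>a\<in>F. \<exists>n. visits M (acts M - \<alpha>f) (unreachable_except M B F) T a n t"
  have "finite F"
    using cycle(2) M by (auto simp: finite_lts_def intro: finite_subset)
  then obtain \<pi> where \<pi>: "is_path M \<pi>" "pstate \<pi> 0 = s" "plen \<pi> = \<infinity>"
    "\<forall>i. pstate \<pi> i \<in> unreachable_except M B F" "\<forall>i. label (ptrans \<pi> i) \<in> acts M - \<alpha>f"
    "\<forall>a\<in>F. \<forall>i. \<exists>j\<ge>i. label (ptrans \<pi> j) = a"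
    using ex_cyclic_path[OF M \<open>finite F\<close> cycle(1) _ cycle(4), of "acts M - \<alpha>f" "unreachable_except M B F"]
      cycle(5) by blast
  then have "strong_hyperfair M B \<pi>"
    using strong_hyperfairI[of \<pi> M B F] by blast
  moreover have "free_of \<alpha>f \<pi>"
    using \<pi>(5) by (auto simp: free_of_def occurs_def)
  ultimately show ?thesis
    using \<pi> by (auto simp: progressing_def)
qed

theorem theorem29:
  fixes M :: "('s, 'a) lts"
    and B \<alpha>f \<alpha>e :: "'a set"
    and \<rho> :: "'a regular"
  assumes "finite_lts M"
    and "B \<subseteq> acts M"
    and "regular_over (acts M) \<rho>"
    and "\<alpha>f \<subseteq> acts M"
    and "\<alpha>e \<subseteq> acts M"
  shows "satisfies M
      (Neg (dia (Seq \<rho> (Star (Acts (acts M - \<alpha>f))))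
        (Or (dia (Acts \<alpha>e) TT)
        (Or (box (Acts (acts M - B)) FF)
            (big_or {F. F \<noteq> {} \<and> F \<subseteq> acts M - B} (\<lambda>F.
               Nu ''X'' (big_and F (\<lambda>a.
                 Mu ''W'' (And
                   (big_and ((acts M - B) - F) (\<lambda>b.
                      box (Seq (Star (Acts (acts M - B))) (Acts {b})) FF))
                   (Or (dia (Acts ({a} - \<alpha>f)) (Var ''X''))
                       (dia (Acts (acts M - \<alpha>f)) (Var ''W''))))))))))))
    \<longleftrightarrow>
    \<not> (\<exists>\<pi>. is_path M \<pi> \<and> pstate \<pi> 0 = init M \<and> progressing M B \<pi>
          \<and> strong_hyperfair M B \<pi> \<and> violating \<rho> \<alpha>f \<alpha>e \<pi>)"
proof -
  let ?goal = "goal M B \<alpha>f \<alpha>e"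
  have init: "init M \<in> states M"
    using assms(1) by (simp add: finite_lts_def)
  \<comment> \<open>Both sides of the theorem are negations; the equivalence is shown for the
    negated statements.\<close>
  have "(\<exists>u v s. u \<in> lang \<rho> \<and> set v \<inter> \<alpha>f = {} \<and> run M (init M) (u @ v) s \<and> s \<in> sem M (\<lambda>_. {}) ?goal)
    \<longleftrightarrow> (\<exists>\<pi>. is_path M \<pi> \<and> pstate \<pi> 0 = init M \<and> progressing M B \<pi>
          \<and> strong_hyperfair M B \<pi> \<and> violating \<rho> \<alpha>f \<alpha>e \<pi>)" (is "?l \<longleftrightarrow> ?r")
  proof
    assume ?l
    then obtain u v t s where u: "u \<in> lang \<rho>" "run M (init M) u t"
      and v: "set v \<inter> \<alpha>f = {}" "run M t v s" and s: "s \<in> sem M (\<lambda>_. {}) ?goal"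
      by (auto simp: run_append)
    have "s \<in> states M"
      using run_states[OF assms(1)] u v init by blast
    then obtain \<tau> where \<tau>: "is_path M \<tau>" "pstate \<tau> 0 = s" "progressing M B \<tau>" "strong_hyperfair M B \<tau>"
      "free_of \<alpha>f \<tau> \<or> 0 < plen \<tau> \<and> label (ptrans \<tau> 0) \<in> \<alpha>e"
      using ex_fair_path_of_goal[OF assms(1,5) _ s] by blast
    obtain \<sigma> where \<sigma>: "is_path M \<sigma>" "pstate \<sigma> 0 = t" "plen \<sigma> = enat (length v) + plen \<tau>"
      "path_drop (length v) \<sigma> = \<tau>" "\<forall>i<length v. label (ptrans \<sigma> i) = v ! i"
      using ex_path_append[OF assms(1) v(2) \<tau>(1,2)] by blast
    obtain \<pi> where \<pi>: "is_path M \<pi>" "pstate \<pi> 0 = init M" "plen \<pi> = enat (length u) + plen \<sigma>"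
      "path_drop (length u) \<pi> = \<sigma>" "\<forall>i<length u. label (ptrans \<pi> i) = u ! i"
      using ex_path_append[OF assms(1) u(2) \<sigma>(1,2)] by blast
    have len: "enat (length v) \<le> plen \<sigma>" "enat (length u) \<le> plen \<pi>"
      by (simp_all add: \<sigma>(3) \<pi>(3))
    have "progressing M B \<pi>" "strong_hyperfair M B \<pi>"
      using \<tau>(3,4) \<sigma>(4) \<pi>(4) progressing_path_drop len strong_hyperfair_path_drop by metis+
    moreover have "matches (path_take (length u) \<pi>) \<rho>"
    proof -
      have "map (\<lambda>i. label (ptrans \<pi> i)) [0..<length u] = u"
        using \<pi>(5) by (intro nth_equalityI) auto
      then show ?thesis
        using u(1) by (simp add: matches_def)
    qed
    moreover have \<alpha>f_v: "label (ptrans \<sigma> i) \<notin> \<alpha>f" if "i < length v" for i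
      using that \<sigma>(5) v(1) nth_mem by fastforce
    moreover have drop_v: "ptrans \<sigma> (length v + i) = ptrans \<tau> i" for i
      using \<sigma>(4) path_drop_simps(3) by metis
    moreover have "violating \<rho> \<alpha>f \<alpha>e \<pi>" if m: "matches (path_take (length u) \<pi>) \<rho>"
      using \<tau>(5)
    proof
      assume free: "free_of \<alpha>f \<tau>"
      \<comment> \<open>Positions below \<open>length v\<close> carry letters of \<open>v\<close>,
        later ones belong to \<open>\<tau>\<close>.\<close>
      have "label (ptrans \<sigma> i) \<notin> \<alpha>f" if i: "enat i < plen \<sigma>" for i
      proof (cases "i < length v")
        case False
        then have "enat (i - length v) < plen \<tau>"
          using i \<sigma>(3) by (cases "plen \<tau>") auto
        then show ?thesis
          using free drop_v[of "i - length v"] False by (auto simp: free_of_def occurs_def)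
      qed (rule \<alpha>f_v)
      then have "free_of \<alpha>f \<sigma>"
        by (auto simp: free_of_def occurs_def)
      then show ?thesis
        using m len(2) \<pi>(4) unfolding violating_def Let_def by blast
    next
      assume exit: "0 < plen \<tau> \<and> label (ptrans \<tau> 0) \<in> \<alpha>e"
      have "enat (length v) < plen \<sigma>"
        using exit \<sigma>(3) by (cases "plen \<tau>") (auto simp: enat_0_iff zero_enat_def)
      moreover have "label (ptrans \<sigma> (length v)) \<in> \<alpha>e"
        using exit drop_v[of 0] by simp
      moreover have "free_of \<alpha>f (path_take (length v) \<sigma>)"
        using \<alpha>f_v by (auto simp: free_of_def occurs_def)
      \<comment> \<open>\<open>v\<close> may already contain actions of \<open>\<alpha>e\<close>, so
        the exit at \<open>length v\<close> need not be the first one;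
        \<open>violating_first\<close> takes care of this.\<close>
      ultimately show ?thesis
        using violating_first[OF len(2) m, of "length v"] unfolding \<pi>(4) by blast
    qed
    ultimately show ?r
      using \<pi>(1,2) by blast
  next
    assume ?r
    then obtain \<pi> k where \<pi>: "is_path M \<pi>" "pstate \<pi> 0 = init M" "progressing M B \<pi>" "strong_hyperfair M B \<pi>"
      and k: "enat k \<le> plen \<pi>" "matches (path_take k \<pi>) \<rho>"
      and viol: "free_of \<alpha>f (path_drop k \<pi>) \<or>
           (\<exists>j. enat j < plen (path_drop k \<pi>) \<and> label (ptrans (path_drop k \<pi>) j) \<in> \<alpha>e
              \<and> free_of \<alpha>f (path_take j (path_drop k \<pi>)))"
      unfolding violating_def Let_def by blast
    let ?w = "\<lambda>i j. map (\<lambda>n. label (ptrans \<pi> n)) [i..<j]"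
    have "\<exists>m\<ge>k. enat m \<le> plen \<pi> \<and> set (?w k m) \<inter> \<alpha>f = {} \<and> pstate \<pi> m \<in> sem M (\<lambda>_. {}) ?goal"
      using viol
    proof
      assume free: "free_of \<alpha>f (path_drop k \<pi>)"
      then obtain m where m: "m \<ge> k" "enat m \<le> plen \<pi>" "pstate \<pi> m \<in> sem M (\<lambda>_. {}) ?goal"
        using goal_of_fair_free_path[OF assms(1) \<pi>(1,3,4) assms(5) k(1)] by blast
      have "label (ptrans \<pi> i) \<notin> \<alpha>f" if "i \<ge> k" "i < m" for i
      proof -
        have "enat (i - k) < plen (path_drop k \<pi>)"
          using that m(2) k(1) by (cases "plen \<pi>") auto
        then show ?thesis
          using free that by (fastforce simp: free_of_def occurs_def)
      qed
      with m show ?thesis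
        by (intro exI[of _ m]) (auto simp del: sem.simps)
    next
      assume "\<exists>j. enat j < plen (path_drop k \<pi>) \<and> label (ptrans (path_drop k \<pi>) j) \<in> \<alpha>e
              \<and> free_of \<alpha>f (path_take j (path_drop k \<pi>))"
      then obtain j where j: "enat (k + j) < plen \<pi>" "label (ptrans \<pi> (k + j)) \<in> \<alpha>e"
        "free_of \<alpha>f (path_take j (path_drop k \<pi>))"
        using k(1) by (auto simp: less_enat_diff_iff)
      have "label (ptrans \<pi> i) \<notin> \<alpha>f" if "i \<ge> k" "i < k + j" for i
        using j(3) that by (auto simp: free_of_def occurs_def dest!: bspec spec[of _ "i - k"])
      then have "set (?w k (k + j)) \<inter> \<alpha>f = {}"
        by auto
      \<comment> \<open>The \<open>\<alpha>e\<close>-transition leaving this state satisfies the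
        first disjunct.\<close>
      moreover have "pstate \<pi> (k + j) \<in> sem M (\<lambda>_. {}) ?goal"
        using is_path_step[OF \<pi>(1) j(1)] j(2) is_path_state[OF assms(1) \<pi>(1), of "k + j"] j(1)
        by (subst sem_goal[OF assms(1,5)]) (auto intro: less_imp_le)
      ultimately show ?thesis
        using j(1) by (intro exI[of _ "k + j"]) (auto simp del: sem.simps)
    qed
    then obtain m where m: "m \<ge> k" "enat m \<le> plen \<pi>" "set (?w k m) \<inter> \<alpha>f = {}"
      "pstate \<pi> m \<in> sem M (\<lambda>_. {}) ?goal"
      by blast
    have "run M (init M) (?w 0 k) (pstate \<pi> k)"
      using path_run[OF \<pi>(1), of 0 k] k(1) \<pi>(2) by simp
    moreover have "run M (pstate \<pi> k) (?w k m) (pstate \<pi> m)"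
      using path_run[OF \<pi>(1), of k "m - k"] m(1,2) by simp
    ultimately have "run M (init M) (?w 0 k @ ?w k m) (pstate \<pi> m)"
      unfolding run_append by blast
    moreover have "?w 0 k \<in> lang \<rho>"
      using k(2) by (simp add: matches_def)
    ultimately show ?l
      using m(3,4) by blast
  qed
  then show ?thesis
    unfolding satisfies_iff_run[OF assms(1,3)] by simp
qed

end
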